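(* Let $(F,F^{\diamond},\eta^{F,l},\eta^{F,r},\varepsilon^{F,l},\varepsilon^{F,r})$ be an adjunction in a semigroup category $\mathcal{S}$, and let $\mathbf{M}$ be a semigroup $\mathcal{S}$-module category. The adjunction $(F,F^{\diamond},\eta^{F,l},\eta^{F,r},\varepsilon^{F,l},\varepsilon^{F,r})$ is respected in $\mathbf{M}$ if and only if the adjoint pair $(F,F^{\diamond})$ is preserved in $\mathbf{M}$, i.e. if and only if the pair of functors $(\mathbf{M}F,\mathbf{M}F^{\diamond})$ is an adjoint pair ($\mathbf{M}F$ left adjoint to $\mathbf{M}F^{\diamond}$).
   Context: $\Bbbk$ is a field; all categories and functors are $\Bbbk$-linear. A *semigroup category* is a category $\mathcal{S}$ with a bilinear functor $\boxtimes$ and an associativity isomorphism satisfying the pentagon axiom; no unit object is required. A (left) semigroup $\mathcal{S}$-module category is a category $\mathbf{M}$ with a bilinear action functor $\star:\mathcal{S}\otimes_{\Bbbk}\mathbf{M}\to\mathbf{M}$ and coherent natural isomorphisms $(G\boxtimes F)\star X\simeq G\star(F\star X)$, no unit condition being imposed; $\mathbf{M}F$ denotes the endofunctor $F\star-$ of $\mathbf{M}$. Module functors and transformations are defined as for monoidal categories without unit conditions. Coherence isomorphisms are suppressed. An *adjunction* in $\mathcal{S}$ is a tuple $(F,F^{\diamond},\eta^{l},\eta^{r},\varepsilon^{l},\varepsilon^{r})$ with $F,F^{\diamond}\in\mathcal{S}$, left $\mathcal{S}$-module transformations $\eta^{l}:\mathrm{Id}_{\mathcal{S}}\to -\boxtimes(F^{\diamond}\boxtimes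 F)$, $\varepsilon^{l}:-\boxtimes(F\boxtimes F^{\diamond})\to\mathrm{Id}_{\mathcal{S}}$, and right $\mathcal{S}$-module transformations $\eta^{r}:\mathrm{Id}_{\mathcal{S}}\to(F^{\diamond}\boxtimes F)\boxtimes-$, $\varepsilon^{r}:(F\boxtimes F^{\diamond})\boxtimes-\to\mathrm{Id}_{\mathcal{S}}$, such that: (I) $(-\boxtimes F^{\diamond},-\boxtimes F,\eta^{l},\varepsilon^{l})$ is an adjunction (left adjoint first) of left $\mathcal{S}$-module endofunctors of $\mathcal{S}$; (II) $(F\boxtimes-,F^{\diamond}\boxtimes-,\eta^{r},\varepsilon^{r})$ is an adjunction of right $\mathcal{S}$-module endofunctors; (III) $\varepsilon^{r}_{F}\circ\eta^{l}_{F}=\mathrm{id}_{F}$ and $\varepsilon^{l}_{F^{\diamond}}\circ\eta^{r}_{F^{\diamond}}=\mathrm{id}_{F^{\diamond}}$; (IV) for all $H,K\in\mathcal{S}$, $H\boxtimes\eta^{r}_{K}=\eta^{l}_{H}\boxtimes K$ and $H\boxtimes\varepsilon^{r}_{K}=\varepsilon^{l}_{H}\boxtimes K$. The adjunction is *respected in $\mathbf{M}$* if there is an ordinary adjunction $(\mathbf{M}F,\mathbf{M}F^{\diamond},\eta^{F,\mathbf{M}},\varepsilon^{F,\mathbf{M}})$ such that $H\star\varepsilon^{F,\mathbf{M}}_{X}=\varepsilon^{F,l}_{H}\star X$ and $H\star\eta^{F,\mathbf{M}}_{X}=\eta^{F,l}_{H}\star X$ for all $H\in\mathcal{S}$ and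 $X\in\mathbf{M}$. *)

theory Defs
  imports "HOL-Algebra.Module"
begin

section \<open>Linear categories and functors\<close>

definition linear_map ::
    "('k, 'r) ring_scheme \<Rightarrow> ('k, 'a, 's) module_scheme \<Rightarrow> ('k, 'b, 't) module_scheme \<Rightarrow> ('a \<Rightarrow> 'b) \<Rightarrow> bool"
  where "linear_map K V W f \<longleftrightarrow>
    f \<in> carrier V \<rightarrow> carrier W \<and>
    (\<forall>x\<in>carrier V. \<forall>y\<in>carrier V. f (x \<oplus>\<^bsub>V\<^esub> y) = f x \<oplus>\<^bsub>W\<^esub> f y) \<and>
    (\<forall>c\<in>carrier K. \<forall>x\<in>carrier V. f (c \<odot>\<^bsub>V\<^esub> x) = c \<odot>\<^bsub>W\<^esub> f x)"

definition bilinear_map ::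
    "('k, 'r) ring_scheme \<Rightarrow> ('k, 'a, 's) module_scheme \<Rightarrow> ('k, 'b, 't) module_scheme \<Rightarrow>
     ('k, 'c, 'u) module_scheme \<Rightarrow> ('a \<Rightarrow> 'b \<Rightarrow> 'c) \<Rightarrow> bool"
  where "bilinear_map K U V W b \<longleftrightarrow>
    (\<forall>u\<in>carrier U. linear_map K V W (b u)) \<and>
    (\<forall>v\<in>carrier V. linear_map K U W (\<lambda>u. b u v))"

text \<open>Each hom-space is a HOL-Algebra module record; its ring multiplication and unit
  are never used.\<close>

record ('o, 'a, 'k) lcat =
  Ob :: "'o set"
  Hom :: "'o \<Rightarrow> 'o \<Rightarrow> ('k, 'a) module"
  Comp :: "'a \<Rightarrow> 'a \<Rightarrow> 'a"  (infixr \<open>\<cdot>\<index>\<close> 70)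
  Ident :: "'o \<Rightarrow> 'a"

abbreviation hom_set :: "('o, 'a, 'k, 'z) lcat_scheme \<Rightarrow> 'o \<Rightarrow> 'o \<Rightarrow> 'a set"
  where "hom_set C A B \<equiv> carrier (Hom C A B)"

text \<open>Composition is written in the usual order: \<open>g \<cdot>\<^bsub>C\<^esub> f\<close> is \<open>g\<close> after \<open>f\<close>. It is not
  indexed by objects; this is no restriction, since distinct hom-sets are disjoint.\<close>

locale linear_category = field K for K (structure) +
  fixes C :: "('o, 'a, 'k, 'z) lcat_scheme"
  assumes module_Hom: "\<lbrakk>A \<in> Ob C; B \<in> Ob C\<rbrakk> \<Longrightarrow> module K (Hom C A B)"
    and Hom_disjoint:
      "\<lbrakk>A \<in> Ob C; B \<in> Ob C; A' \<in> Ob C; B' \<in> Ob C; f \<in> hom_set C A B; f \<in> hom_set C A' B'\<rbrakk>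
        \<Longrightarrow> A = A' \<and> B = B'"
    and Ident_in_hom: "A \<in> Ob C \<Longrightarrow> Ident C A \<in> hom_set C A A"
    and Comp_bilinear:
      "\<lbrakk>A \<in> Ob C; B \<in> Ob C; D \<in> Ob C\<rbrakk>
        \<Longrightarrow> bilinear_map K (Hom C B D) (Hom C A B) (Hom C A D) (Comp C)"
    and Comp_Ident:
      "\<lbrakk>A \<in> Ob C; B \<in> Ob C; f \<in> hom_set C A B\<rbrakk> \<Longrightarrow> f \<cdot>\<^bsub>C\<^esub> Ident C A = f"
    and Ident_Comp:
      "\<lbrakk>A \<in> Ob C; B \<in> Ob C; f \<in> hom_set C A B\<rbrakk> \<Longrightarrow> Ident C B \<cdot>\<^bsub>C\<^esub> f = f"
    and Comp_assoc:
      "\<lbrakk>A \<in> Ob C; B \<in> Ob C; D \<in> Ob C; E \<in> Ob C;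
        f \<in> hom_set C A B; g \<in> hom_set C B D; h \<in> hom_set C D E\<rbrakk>
        \<Longrightarrow> (h \<cdot>\<^bsub>C\<^esub> g) \<cdot>\<^bsub>C\<^esub> f = h \<cdot>\<^bsub>C\<^esub> (g \<cdot>\<^bsub>C\<^esub> f)"

definition inverse_arrows :: "('o, 'a, 'k, 'z) lcat_scheme \<Rightarrow> 'o \<Rightarrow> 'o \<Rightarrow> 'a \<Rightarrow> 'a \<Rightarrow> bool"
  where "inverse_arrows C A B f g \<longleftrightarrow>
    f \<in> hom_set C A B \<and> g \<in> hom_set C B A \<and> g \<cdot>\<^bsub>C\<^esub> f = Ident C A \<and> f \<cdot>\<^bsub>C\<^esub> g = Ident C B"

definition iso_arrow :: "('o, 'a, 'k, 'z) lcat_scheme \<Rightarrow> 'o \<Rightarrow> 'o \<Rightarrow> 'a \<Rightarrow> bool"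
  where "iso_arrow C A B f \<longleftrightarrow> (\<exists>g. inverse_arrows C A B f g)"

definition inv_arrow :: "('o, 'a, 'k, 'z) lcat_scheme \<Rightarrow> 'o \<Rightarrow> 'o \<Rightarrow> 'a \<Rightarrow> 'a"
  where "inv_arrow C A B f = (THE g. inverse_arrows C A B f g)"

record ('o, 'a, 'p, 'b) fctr =
  fobj :: "'o \<Rightarrow> 'p"
  farr :: "'a \<Rightarrow> 'b"

locale linear_functor = C: linear_category K C + D: linear_category K D
  for K (structure)
    and C :: "('o, 'a, 'k, 'y) lcat_scheme"
    and D :: "('p, 'b, 'k, 'z) lcat_scheme" +
  fixes T :: "('o, 'a, 'p, 'b) fctr"
  assumes fobj_closed: "A \<in> Ob C \<Longrightarrow> fobj T A \<in> Ob D"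
    and farr_linear:
      "\<lbrakk>A \<in> Ob C; B \<in> Ob C\<rbrakk>
        \<Longrightarrow> linear_map K (Hom C A B) (Hom D (fobj T A) (fobj T B)) (farr T)"
    and farr_Ident: "A \<in> Ob C \<Longrightarrow> farr T (Ident C A) = Ident D (fobj T A)"
    and farr_Comp:
      "\<lbrakk>A \<in> Ob C; B \<in> Ob C; E \<in> Ob C; f \<in> hom_set C A B; g \<in> hom_set C B E\<rbrakk>
        \<Longrightarrow> farr T (g \<cdot>\<^bsub>C\<^esub> f) = farr T g \<cdot>\<^bsub>D\<^esub> farr T f"

definition id_fctr :: "('o, 'a, 'o, 'a) fctr"
  where "id_fctr = \<lparr>fobj = (\<lambda>X. X), farr = (\<lambda>f. f)\<rparr>"

definition comp_fctr ::
    "('p, 'b, 'q, 'c) fctr \<Rightarrow> ('o, 'a, 'p, 'b) fctr \<Rightarrow> ('o, 'a, 'q, 'c) fctr"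
  where "comp_fctr U T = \<lparr>fobj = (\<lambda>X. fobj U (fobj T X)), farr = (\<lambda>f. farr U (farr T f))\<rparr>"

text \<open>A bilinear functor from the pair \<open>B, C\<close> to \<open>D\<close>, i.e. a linear functor on the tensor
  product of linear categories, with object map \<open>to\<close> and arrow map \<open>ta\<close>.\<close>

locale bilinear_functor =
  B: linear_category K B + C: linear_category K C + D: linear_category K D
  for K (structure)
    and B :: "('o, 'a, 'k, 'x) lcat_scheme"
    and C :: "('p, 'b, 'k, 'y) lcat_scheme"
    and D :: "('q, 'c, 'k, 'z) lcat_scheme" +
  fixes to :: "'o \<Rightarrow> 'p \<Rightarrow> 'q" and ta :: "'a \<Rightarrow> 'b \<Rightarrow> 'c"
  assumes to_closed: "\<lbrakk>X \<in> Ob B; Y \<in> Ob C\<rbrakk> \<Longrightarrow> to X Y \<in> Ob D"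
    and ta_bilinear:
      "\<lbrakk>X \<in> Ob B; X' \<in> Ob B; Y \<in> Ob C; Y' \<in> Ob C\<rbrakk>
        \<Longrightarrow> bilinear_map K (Hom B X X') (Hom C Y Y') (Hom D (to X Y) (to X' Y')) ta"
    and ta_Ident:
      "\<lbrakk>X \<in> Ob B; Y \<in> Ob C\<rbrakk> \<Longrightarrow> ta (Ident B X) (Ident C Y) = Ident D (to X Y)"
    and ta_Comp:
      "\<lbrakk>X \<in> Ob B; X' \<in> Ob B; X'' \<in> Ob B; Y \<in> Ob C; Y' \<in> Ob C; Y'' \<in> Ob C;
        f \<in> hom_set B X X'; f' \<in> hom_set B X' X''; g \<in> hom_set C Y Y'; g' \<in> hom_set C Y' Y''\<rbrakk>
        \<Longrightarrow> ta (f' \<cdot>\<^bsub>B\<^esub> f) (g' \<cdot>\<^bsub>C\<^esub> g) = ta f' g' \<cdot>\<^bsub>D\<^esub> ta f g"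

definition nat_transf ::
    "('o, 'a, 'k, 'y) lcat_scheme \<Rightarrow> ('p, 'b, 'k, 'z) lcat_scheme \<Rightarrow>
     ('o, 'a, 'p, 'b) fctr \<Rightarrow> ('o, 'a, 'p, 'b) fctr \<Rightarrow> ('o \<Rightarrow> 'b) \<Rightarrow> bool"
  where "nat_transf C D T U t \<longleftrightarrow>
    (\<forall>X\<in>Ob C. t X \<in> hom_set D (fobj T X) (fobj U X)) \<and>
    (\<forall>X\<in>Ob C. \<forall>Y\<in>Ob C. \<forall>f\<in>hom_set C X Y. t Y \<cdot>\<^bsub>D\<^esub> farr T f = farr U f \<cdot>\<^bsub>D\<^esub> t X)"

locale adjunction = L: linear_functor K C D L + R: linear_functor K D C R
  for K (structure)
    and C :: "('o, 'a, 'k, 'y) lcat_scheme"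
    and D :: "('p, 'b, 'k, 'z) lcat_scheme"
    and L :: "('o, 'a, 'p, 'b) fctr"
    and R :: "('p, 'b, 'o, 'a) fctr" +
  fixes \<eta> :: "'o \<Rightarrow> 'a" and \<epsilon> :: "'p \<Rightarrow> 'b"
  assumes unit_nat: "nat_transf C C id_fctr (comp_fctr R L) \<eta>"
    and counit_nat: "nat_transf D D (comp_fctr L R) id_fctr \<epsilon>"
    and triangle_L: "X \<in> Ob C \<Longrightarrow> \<epsilon> (fobj L X) \<cdot>\<^bsub>D\<^esub> farr L (\<eta> X) = Ident D (fobj L X)"
    and triangle_R: "Y \<in> Ob D \<Longrightarrow> farr R (\<epsilon> Y) \<cdot>\<^bsub>C\<^esub> \<eta> (fobj R Y) = Ident C (fobj R Y)"

definition adjoint_pair ::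
    "('k, 'r) ring_scheme \<Rightarrow> ('o, 'a, 'k, 'y) lcat_scheme \<Rightarrow> ('p, 'b, 'k, 'z) lcat_scheme \<Rightarrow>
     ('o, 'a, 'p, 'b) fctr \<Rightarrow> ('p, 'b, 'o, 'a) fctr \<Rightarrow> bool"
  where "adjoint_pair K C D L R \<longleftrightarrow> (\<exists>\<eta> \<epsilon>. adjunction K C D L R \<eta> \<epsilon>)"


section \<open>Semigroup categories\<close>

text \<open>\<open>\<boxtimes>\<close> is the product of objects, \<open>\<boxtimes>\<^sub>m\<close> that of morphisms, and
  \<open>assoc S A B C\<close> is the component \<open>(A \<boxtimes> B) \<boxtimes> C \<rightarrow> A \<boxtimes> (B \<boxtimes> C)\<close> of the associator.\<close>

record ('o, 'a, 'k) semigroup_cat = "('o, 'a, 'k) lcat" +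
  tens :: "'o \<Rightarrow> 'o \<Rightarrow> 'o"  (infixl \<open>\<boxtimes>\<index>\<close> 75)
  tens_arr :: "'a \<Rightarrow> 'a \<Rightarrow> 'a"  (infixl \<open>\<boxtimes>\<^sub>m\<index>\<close> 75)
  assoc :: "'o \<Rightarrow> 'o \<Rightarrow> 'o \<Rightarrow> 'a"

locale semigroup_category = bilinear_functor K S S S "tens S" "tens_arr S"
  for K (structure) and S :: "('o, 'a, 'k, 'z) semigroup_cat_scheme" +
  assumes assoc_iso:
      "\<lbrakk>A \<in> Ob S; B \<in> Ob S; C \<in> Ob S\<rbrakk>
        \<Longrightarrow> iso_arrow S (A \<boxtimes>\<^bsub>S\<^esub> B \<boxtimes>\<^bsub>S\<^esub> C) (A \<boxtimes>\<^bsub>S\<^esub> (B \<boxtimes>\<^bsub>S\<^esub> C)) (assoc S A B C)"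
    and assoc_natural:
      "\<lbrakk>A \<in> Ob S; B \<in> Ob S; C \<in> Ob S; A' \<in> Ob S; B' \<in> Ob S; C' \<in> Ob S;
        f \<in> hom_set S A A'; g \<in> hom_set S B B'; h \<in> hom_set S C C'\<rbrakk>
        \<Longrightarrow> assoc S A' B' C' \<cdot>\<^bsub>S\<^esub> (f \<boxtimes>\<^sub>m\<^bsub>S\<^esub> g \<boxtimes>\<^sub>m\<^bsub>S\<^esub> h)
          = (f \<boxtimes>\<^sub>m\<^bsub>S\<^esub> (g \<boxtimes>\<^sub>m\<^bsub>S\<^esub> h)) \<cdot>\<^bsub>S\<^esub> assoc S A B C"
    and pentagon:
      "\<lbrakk>A \<in> Ob S; B \<in> Ob S; C \<in> Ob S; D \<in> Ob S\<rbrakk>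
        \<Longrightarrow> assoc S A B (C \<boxtimes>\<^bsub>S\<^esub> D) \<cdot>\<^bsub>S\<^esub> assoc S (A \<boxtimes>\<^bsub>S\<^esub> B) C D
          = (Ident S A \<boxtimes>\<^sub>m\<^bsub>S\<^esub> assoc S B C D) \<cdot>\<^bsub>S\<^esub> assoc S A (B \<boxtimes>\<^bsub>S\<^esub> C) D
              \<cdot>\<^bsub>S\<^esub> (assoc S A B C \<boxtimes>\<^sub>m\<^bsub>S\<^esub> Ident S D)"

abbreviation inv_assoc :: "('o, 'a, 'k, 'z) semigroup_cat_scheme \<Rightarrow> 'o \<Rightarrow> 'o \<Rightarrow> 'o \<Rightarrow> 'a"
  where "inv_assoc S A B C \<equiv>
    inv_arrow S (A \<boxtimes>\<^bsub>S\<^esub> B \<boxtimes>\<^bsub>S\<^esub> C) (A \<boxtimes>\<^bsub>S\<^esub> (B \<boxtimes>\<^bsub>S\<^esub> C)) (assoc S A B C)"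

text \<open>The same category with the opposite product \<open>(A, B) \<mapsto> B \<boxtimes> A\<close>. Right \<open>S\<close>-module
  notions are left \<open>rev_cat S\<close>-module notions.\<close>

definition rev_cat :: "('o, 'a, 'k, 'z) semigroup_cat_scheme \<Rightarrow> ('o, 'a, 'k, 'z) semigroup_cat_scheme"
  where "rev_cat S = S\<lparr>tens := (\<lambda>A B. B \<boxtimes>\<^bsub>S\<^esub> A), tens_arr := (\<lambda>f g. g \<boxtimes>\<^sub>m\<^bsub>S\<^esub> f),
    assoc := (\<lambda>A B C. inv_assoc S C B A)\<rparr>"


section \<open>Module categories\<close>

text \<open>\<open>act_assoc M G F X\<close> is the component \<open>(G \<boxtimes> F) \<star> X \<rightarrow> G \<star> (F \<star> X)\<close> of the
  coherence isomorphism.\<close>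

record ('s, 't, 'o, 'a, 'k) module_cat = "('o, 'a, 'k) lcat" +
  act :: "'s \<Rightarrow> 'o \<Rightarrow> 'o"  (infixr \<open>\<star>\<index>\<close> 73)
  act_arr :: "'t \<Rightarrow> 'a \<Rightarrow> 'a"  (infixr \<open>\<star>\<^sub>m\<index>\<close> 73)
  act_assoc :: "'s \<Rightarrow> 's \<Rightarrow> 'o \<Rightarrow> 'a"

locale semigroup_module_category =
  S: semigroup_category K S + bilinear_functor K S M M "act M" "act_arr M"
  for K (structure)
    and S :: "('s, 't, 'k, 'y) semigroup_cat_scheme"
    and M :: "('s, 't, 'o, 'a, 'k, 'z) module_cat_scheme" +
  assumes act_assoc_iso:
      "\<lbrakk>G \<in> Ob S; F \<in> Ob S; X \<in> Ob M\<rbrakk>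
        \<Longrightarrow> iso_arrow M ((G \<boxtimes>\<^bsub>S\<^esub> F) \<star>\<^bsub>M\<^esub> X) (G \<star>\<^bsub>M\<^esub> F \<star>\<^bsub>M\<^esub> X) (act_assoc M G F X)"
    and act_assoc_natural:
      "\<lbrakk>G \<in> Ob S; F \<in> Ob S; X \<in> Ob M; G' \<in> Ob S; F' \<in> Ob S; X' \<in> Ob M;
        g \<in> hom_set S G G'; f \<in> hom_set S F F'; x \<in> hom_set M X X'\<rbrakk>
        \<Longrightarrow> act_assoc M G' F' X' \<cdot>\<^bsub>M\<^esub> ((g \<boxtimes>\<^sub>m\<^bsub>S\<^esub> f) \<star>\<^sub>m\<^bsub>M\<^esub> x)
          = (g \<star>\<^sub>m\<^bsub>M\<^esub> f \<star>\<^sub>m\<^bsub>M\<^esub> x) \<cdot>\<^bsub>M\<^esub> act_assoc M G F X"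
    and act_coherence:
      "\<lbrakk>H \<in> Ob S; G \<in> Ob S; F \<in> Ob S; X \<in> Ob M\<rbrakk>
        \<Longrightarrow> act_assoc M H G (F \<star>\<^bsub>M\<^esub> X) \<cdot>\<^bsub>M\<^esub> act_assoc M (H \<boxtimes>\<^bsub>S\<^esub> G) F X
          = (Ident S H \<star>\<^sub>m\<^bsub>M\<^esub> act_assoc M G F X) \<cdot>\<^bsub>M\<^esub> act_assoc M H (G \<boxtimes>\<^bsub>S\<^esub> F) X
              \<cdot>\<^bsub>M\<^esub> (assoc S H G F \<star>\<^sub>m\<^bsub>M\<^esub> Ident M X)"

text \<open>The endofunctor \<open>F \<star> -\<close> of \<open>M\<close>.\<close>

definition act_fctr ::
    "('s, 't, 'k, 'y) semigroup_cat_scheme \<Rightarrow> ('s, 't, 'o, 'a, 'k, 'z) module_cat_scheme \<Rightarrow>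
     's \<Rightarrow> ('o, 'a, 'o, 'a) fctr"
  where "act_fctr S M F =
    \<lparr>fobj = (\<lambda>X. F \<star>\<^bsub>M\<^esub> X), farr = (\<lambda>f. Ident S F \<star>\<^sub>m\<^bsub>M\<^esub> f)\<rparr>"

text \<open>A module functor from \<open>M\<close> to \<open>N\<close> is a functor \<open>T\<close> together with isomorphisms
  \<open>s H X\<close> from \<open>T (H \<star> X)\<close> to \<open>H \<star> T X\<close>.\<close>

locale module_functor =
  M: semigroup_module_category K S M + N: semigroup_module_category K S N + linear_functor K M N T
  for K (structure)
    and S :: "('s, 't, 'k, 'x) semigroup_cat_scheme"
    and M :: "('s, 't, 'o, 'a, 'k, 'y) module_cat_scheme"
    and N :: "('s, 't, 'p, 'b, 'k, 'z) module_cat_scheme"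
    and T :: "('o, 'a, 'p, 'b) fctr" +
  fixes s :: "'s \<Rightarrow> 'o \<Rightarrow> 'b"
  assumes str_iso:
      "\<lbrakk>H \<in> Ob S; X \<in> Ob M\<rbrakk>
        \<Longrightarrow> iso_arrow N (fobj T (H \<star>\<^bsub>M\<^esub> X)) (H \<star>\<^bsub>N\<^esub> fobj T X) (s H X)"
    and str_natural:
      "\<lbrakk>H \<in> Ob S; H' \<in> Ob S; X \<in> Ob M; X' \<in> Ob M; h \<in> hom_set S H H'; x \<in> hom_set M X X'\<rbrakk>
        \<Longrightarrow> s H' X' \<cdot>\<^bsub>N\<^esub> farr T (h \<star>\<^sub>m\<^bsub>M\<^esub> x) = (h \<star>\<^sub>m\<^bsub>N\<^esub> farr T x) \<cdot>\<^bsub>N\<^esub> s H X"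
    and str_coherence:
      "\<lbrakk>H \<in> Ob S; G \<in> Ob S; X \<in> Ob M\<rbrakk>
        \<Longrightarrow> act_assoc N H G (fobj T X) \<cdot>\<^bsub>N\<^esub> s (H \<boxtimes>\<^bsub>S\<^esub> G) X
          = (Ident S H \<star>\<^sub>m\<^bsub>N\<^esub> s G X) \<cdot>\<^bsub>N\<^esub> s H (G \<star>\<^bsub>M\<^esub> X) \<cdot>\<^bsub>N\<^esub> farr T (act_assoc M H G X)"

definition id_str :: "('s, 't, 'o, 'a, 'k, 'z) module_cat_scheme \<Rightarrow> 's \<Rightarrow> 'o \<Rightarrow> 'a"
  where "id_str M H X = Ident M (H \<star>\<^bsub>M\<^esub> X)"

text \<open>The structure of the composite of \<open>(T, s)\<close> followed by \<open>(U, u)\<close>, where \<open>N\<close> is the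
  target of \<open>U\<close>.\<close>

definition comp_str ::
    "('s, 't, 'q, 'c, 'k, 'z) module_cat_scheme \<Rightarrow>
     ('p, 'b, 'q, 'c) fctr \<Rightarrow> ('s \<Rightarrow> 'p \<Rightarrow> 'c) \<Rightarrow>
     ('o, 'a, 'p, 'b) fctr \<Rightarrow> ('s \<Rightarrow> 'o \<Rightarrow> 'b) \<Rightarrow> 's \<Rightarrow> 'o \<Rightarrow> 'c"
  where "comp_str N U u T s H X = u H (fobj T X) \<cdot>\<^bsub>N\<^esub> farr U (s H X)"

locale module_transf =
  T: module_functor K S M N T s + U: module_functor K S M N U u
  for K (structure)
    and S :: "('s, 't, 'k, 'x) semigroup_cat_scheme"
    and M :: "('s, 't, 'o, 'a, 'k, 'y) module_cat_scheme"
    and N :: "('s, 't, 'p, 'b, 'k, 'z) module_cat_scheme"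
    and T s U u +
  fixes t :: "'o \<Rightarrow> 'b"
  assumes natural: "nat_transf M N T U t"
    and str_compat:
      "\<lbrakk>H \<in> Ob S; X \<in> Ob M\<rbrakk>
        \<Longrightarrow> u H X \<cdot>\<^bsub>N\<^esub> t (H \<star>\<^bsub>M\<^esub> X) = (Ident S H \<star>\<^sub>m\<^bsub>N\<^esub> t X) \<cdot>\<^bsub>N\<^esub> s H X"

text \<open>An adjunction of module endofunctors \<open>(L, l)\<close> and \<open>(R, r)\<close>: an adjunction whose unit
  and counit are module transformations.\<close>

locale module_adjunction =
  adjunction K M M L R \<eta> \<epsilon> +
  unit: module_transf K S M M id_fctr "id_str M" "comp_fctr R L" "comp_str M R r L l" \<eta> +
  counit: module_transf K S M M "comp_fctr L R" "comp_str M L l R r" id_fctr "id_str M" \<epsilon> +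
  L: module_functor K S M M L l + R: module_functor K S M M R r
  for K (structure)
    and S :: "('s, 't, 'k, 'x) semigroup_cat_scheme"
    and M :: "('s, 't, 'o, 'a, 'k, 'y) module_cat_scheme"
    and L l R r \<eta> \<epsilon>


section \<open>Adjunctions in a semigroup category\<close>

text \<open>\<open>S\<close> as a left module category over itself, and its module endofunctor \<open>- \<boxtimes> A\<close>, whose
  structure is \<open>(H \<boxtimes> K) \<boxtimes> A \<rightarrow> H \<boxtimes> (K \<boxtimes> A)\<close>. Over \<open>rev_cat S\<close> these are \<open>S\<close> as a right
  module category over itself and the endofunctor \<open>A \<boxtimes> -\<close>.\<close>

definition regular :: "('o, 'a, 'k, 'z) semigroup_cat_scheme \<Rightarrow> ('o, 'a, 'o, 'a, 'k) module_cat"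
  where "regular S = \<lparr>Ob = Ob S, Hom = Hom S, Comp = Comp S, Ident = Ident S,
    act = tens S, act_arr = tens_arr S, act_assoc = assoc S\<rparr>"

definition mul_fctr :: "('o, 'a, 'k, 'z) semigroup_cat_scheme \<Rightarrow> 'o \<Rightarrow> ('o, 'a, 'o, 'a) fctr"
  where "mul_fctr S A = \<lparr>fobj = (\<lambda>X. X \<boxtimes>\<^bsub>S\<^esub> A), farr = (\<lambda>f. f \<boxtimes>\<^sub>m\<^bsub>S\<^esub> Ident S A)\<rparr>"

definition mul_str :: "('o, 'a, 'k, 'z) semigroup_cat_scheme \<Rightarrow> 'o \<Rightarrow> 'o \<Rightarrow> 'o \<Rightarrow> 'a"
  where "mul_str S A H X = assoc S H X A"

abbreviation unit_transf ::
    "('k, 'r) ring_scheme \<Rightarrow> ('o, 'a, 'k, 'z) semigroup_cat_scheme \<Rightarrow> 'o \<Rightarrow> ('o \<Rightarrow> 'a) \<Rightarrow> bool"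
  where "unit_transf K S A \<eta> \<equiv> module_transf K S (regular S) (regular S)
    id_fctr (id_str (regular S)) (mul_fctr S A) (mul_str S A) \<eta>"

abbreviation counit_transf ::
    "('k, 'r) ring_scheme \<Rightarrow> ('o, 'a, 'k, 'z) semigroup_cat_scheme \<Rightarrow> 'o \<Rightarrow> ('o \<Rightarrow> 'a) \<Rightarrow> bool"
  where "counit_transf K S A \<epsilon> \<equiv> module_transf K S (regular S) (regular S)
    (mul_fctr S A) (mul_str S A) id_fctr (id_str (regular S)) \<epsilon>"

text \<open>\<open>(- \<boxtimes> A, - \<boxtimes> B, \<eta>, \<epsilon>)\<close> is an adjunction of module endofunctors of \<open>S\<close>, for
  \<open>\<eta>\<close> with components \<open>X \<rightarrow> X \<boxtimes> (A \<boxtimes> B)\<close> and \<open>\<epsilon>\<close> with components \<open>X \<boxtimes> (B \<boxtimes> A) \<rightarrow> X\<close>.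
  The associators identify \<open>X \<boxtimes> (A \<boxtimes> B)\<close> with \<open>(X \<boxtimes> A) \<boxtimes> B\<close> and
  \<open>X \<boxtimes> (B \<boxtimes> A)\<close> with \<open>(X \<boxtimes> B) \<boxtimes> A\<close>.\<close>

definition mul_adjunction ::
    "('k, 'r) ring_scheme \<Rightarrow> ('o, 'a, 'k, 'z) semigroup_cat_scheme \<Rightarrow> 'o \<Rightarrow> 'o \<Rightarrow>
     ('o \<Rightarrow> 'a) \<Rightarrow> ('o \<Rightarrow> 'a) \<Rightarrow> bool"
  where "mul_adjunction K S A B \<eta> \<epsilon> \<longleftrightarrow>
    module_adjunction K S (regular S)
      (mul_fctr S A) (mul_str S A) (mul_fctr S B) (mul_str S B)
      (\<lambda>X. inv_assoc S X A B \<cdot>\<^bsub>S\<^esub> \<eta> X)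
      (\<lambda>X. \<epsilon> X \<cdot>\<^bsub>S\<^esub> assoc S X B A)"

text \<open>Note that \<open>F' \<boxtimes> F\<close> in \<open>S\<close> is the product of \<open>F\<close> and \<open>F'\<close>, in this order, in
  \<open>rev_cat S\<close>. In the last four conditions the associators that are usually suppressed are
  written out.\<close>

locale semigroup_adjunction = semigroup_category K S
  for K (structure) and S :: "('o, 'a, 'k, 'z) semigroup_cat_scheme" +
  fixes F F' :: 'o and \<eta>l \<eta>r \<epsilon>l \<epsilon>r :: "'o \<Rightarrow> 'a"
  assumes F_Ob: "F \<in> Ob S" and F'_Ob: "F' \<in> Ob S"
    and \<eta>l_transf: "unit_transf K S (F' \<boxtimes>\<^bsub>S\<^esub> F) \<eta>l"
    and \<epsilon>l_transf: "counit_transf K S (F \<boxtimes>\<^bsub>S\<^esub> F') \<epsilon>l"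
    and \<eta>r_transf: "unit_transf K (rev_cat S) (F' \<boxtimes>\<^bsub>S\<^esub> F) \<eta>r"
    and \<epsilon>r_transf: "counit_transf K (rev_cat S) (F \<boxtimes>\<^bsub>S\<^esub> F') \<epsilon>r"
    and left_adjunction: "mul_adjunction K S F' F \<eta>l \<epsilon>l"
    and right_adjunction: "mul_adjunction K (rev_cat S) F F' \<eta>r \<epsilon>r"
    and zigzag_F: "\<epsilon>r F \<cdot>\<^bsub>S\<^esub> inv_assoc S F F' F \<cdot>\<^bsub>S\<^esub> \<eta>l F = Ident S F"
    and zigzag_F': "\<epsilon>l F' \<cdot>\<^bsub>S\<^esub> assoc S F' F F' \<cdot>\<^bsub>S\<^esub> \<eta>r F' = Ident S F'"
    and unit_exchange:
      "\<lbrakk>H \<in> Ob S; X \<in> Ob S\<rbrakk>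
        \<Longrightarrow> Ident S H \<boxtimes>\<^sub>m\<^bsub>S\<^esub> \<eta>r X
          = assoc S H (F' \<boxtimes>\<^bsub>S\<^esub> F) X \<cdot>\<^bsub>S\<^esub> (\<eta>l H \<boxtimes>\<^sub>m\<^bsub>S\<^esub> Ident S X)"
    and counit_exchange:
      "\<lbrakk>H \<in> Ob S; X \<in> Ob S\<rbrakk>
        \<Longrightarrow> (Ident S H \<boxtimes>\<^sub>m\<^bsub>S\<^esub> \<epsilon>r X) \<cdot>\<^bsub>S\<^esub> assoc S H (F \<boxtimes>\<^bsub>S\<^esub> F') X
          = \<epsilon>l H \<boxtimes>\<^sub>m\<^bsub>S\<^esub> Ident S X"


section \<open>Adjunctions and module categories\<close>

text \<open>The canonical isomorphism from \<open>(H \<boxtimes> (A \<boxtimes> B)) \<star> X\<close> to \<open>H \<star> (A \<star> (B \<star> X))\<close>.\<close>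

definition act_assoc3 ::
    "('s, 't, 'k, 'y) semigroup_cat_scheme \<Rightarrow> ('s, 't, 'o, 'a, 'k, 'z) module_cat_scheme \<Rightarrow>
     's \<Rightarrow> 's \<Rightarrow> 's \<Rightarrow> 'o \<Rightarrow> 'a"
  where "act_assoc3 S M H A B X =
    (Ident S H \<star>\<^sub>m\<^bsub>M\<^esub> act_assoc M A B X) \<cdot>\<^bsub>M\<^esub> act_assoc M H (A \<boxtimes>\<^bsub>S\<^esub> B) X"

definition respected_in ::
    "('k, 'r) ring_scheme \<Rightarrow> ('s, 't, 'k, 'y) semigroup_cat_scheme \<Rightarrow>
     ('s, 't, 'o, 'a, 'k, 'z) module_cat_scheme \<Rightarrow>
     's \<Rightarrow> 's \<Rightarrow> ('s \<Rightarrow> 't) \<Rightarrow> ('s \<Rightarrow> 't) \<Rightarrow> ('s \<Rightarrow> 't) \<Rightarrow> ('s \<Rightarrow> 't) \<Rightarrow> bool"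
  where "respected_in K S M F F' \<eta>l \<eta>r \<epsilon>l \<epsilon>r \<longleftrightarrow>
    (\<exists>\<eta> \<epsilon>. adjunction K M M (act_fctr S M F) (act_fctr S M F') \<eta> \<epsilon> \<and>
      (\<forall>H\<in>Ob S. \<forall>X\<in>Ob M.
        (Ident S H \<star>\<^sub>m\<^bsub>M\<^esub> \<epsilon> X) \<cdot>\<^bsub>M\<^esub> act_assoc3 S M H F F' X = \<epsilon>l H \<star>\<^sub>m\<^bsub>M\<^esub> Ident M X \<and>
        Ident S H \<star>\<^sub>m\<^bsub>M\<^esub> \<eta> X = act_assoc3 S M H F' F X \<cdot>\<^bsub>M\<^esub> (\<eta>l H \<star>\<^sub>m\<^bsub>M\<^esub> Ident M X)))"

definition preserved_in ::
    "('k, 'r) ring_scheme \<Rightarrow> ('s, 't, 'k, 'y) semigroup_cat_scheme \<Rightarrow>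
     ('s, 't, 'o, 'a, 'k, 'z) module_cat_scheme \<Rightarrow> 's \<Rightarrow> 's \<Rightarrow> bool"
  where "preserved_in K S M F F' \<longleftrightarrow>
    adjoint_pair K M M (act_fctr S M F) (act_fctr S M F')"

end

theory Submission
  imports Defs
begin

text \<open>Let \<open>(\<eta>, \<epsilon>)\<close> be any adjunction between \<open>L = F \<star> -\<close> and \<open>R = F' \<star> -\<close>. A counit \<open>\<epsilon>'\<close> with
  \<open>R \<epsilon>'\<^sub>X = e\<^sub>X := \<epsilon>l F' \<star> X\<close> can only be \<open>\<epsilon>'\<^sub>X = \<epsilon>\<^sub>X \<circ> L (e\<^sub>X \<circ> \<eta>\<^bsub>R X\<^esub>)\<close>; dually the unit must be
  \<open>\<eta>'\<^sub>X = R (\<epsilon>\<^bsub>L X\<^esub> \<circ> n\<^sub>X) \<circ> \<eta>\<^sub>X\<close> with \<open>n\<^sub>X = \<eta>l F \<star> X\<close>. Take these as definitions. By (IV),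
  \<open>e\<^bsub>L X\<^esub>\<close> is \<open>R\<close> applied to \<open>\<epsilon>r F \<star> X\<close>, so \<open>\<epsilon>'\<^bsub>L X\<^esub> = \<epsilon>r F \<star> X\<close> by naturality of \<open>\<epsilon>\<close>, and likewise
  \<open>\<eta>'\<^bsub>R X\<^esub> = \<eta>r F' \<star> X\<close>. Hence \<open>H \<star> \<epsilon>'\<close> and \<open>\<epsilon>l H \<star> -\<close> agree on the image of \<open>L\<close>, and then
  everywhere, since both are natural and \<open>L R \<epsilon>\<^sub>X\<close> is a split epimorphism. The triangle
  identities for \<open>(\<eta>', \<epsilon>')\<close> become (III).\<close>

section \<open>Typed arrows\<close>

text \<open>The axioms of a linear category speak only about hom-sets between its objects. Packing
  the object conditions together with hom-set membership lets one typing fact discharge all premises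
  about an arrow.\<close>

definition in_hom :: "('o, 'a, 'k, 'z) lcat_scheme \<Rightarrow> 'a \<Rightarrow> 'o \<Rightarrow> 'o \<Rightarrow> bool"
  where "in_hom C f A B \<longleftrightarrow> A \<in> Ob C \<and> B \<in> Ob C \<and> f \<in> hom_set C A B"

lemma in_homI: "\<lbrakk>A \<in> Ob C; B \<in> Ob C; f \<in> hom_set C A B\<rbrakk> \<Longrightarrow> in_hom C f A B"
  by (simp add: in_hom_def)

context linear_category
begin

lemma Ident_arrow: "A \<in> Ob C \<Longrightarrow> in_hom C (Ident C A) A A"
  by (simp add: in_hom_def Ident_in_hom)

lemma Comp_arrow: "\<lbrakk>in_hom C g B D; in_hom C f A B\<rbrakk> \<Longrightarrow> in_hom C (g \<cdot>\<^bsub>C\<^esub> f) A D"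
  using Comp_bilinear[of A B D]
  by (auto simp: in_hom_def bilinear_map_def linear_map_def Pi_iff)

lemma Comp_Ident_arrow: "in_hom C f A B \<Longrightarrow> f \<cdot>\<^bsub>C\<^esub> Ident C A = f"
  using Comp_Ident[of A B f] by (simp add: in_hom_def)

lemma Ident_Comp_arrow: "in_hom C f A B \<Longrightarrow> Ident C B \<cdot>\<^bsub>C\<^esub> f = f"
  using Ident_Comp[of A B f] by (simp add: in_hom_def)

lemma Comp_assoc_arrow:
  "\<lbrakk>in_hom C h D E; in_hom C g B D; in_hom C f A B\<rbrakk>
    \<Longrightarrow> (h \<cdot>\<^bsub>C\<^esub> g) \<cdot>\<^bsub>C\<^esub> f = h \<cdot>\<^bsub>C\<^esub> g \<cdot>\<^bsub>C\<^esub> f"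
  unfolding in_hom_def by (elim conjE) (rule Comp_assoc[of A B D E]; assumption)

text \<open>Precompose with the section \<open>s\<close>. Equations that naturality gives only after
  a split epimorphism are freed of it in this way.\<close>

lemma split_epi_cancel:
  assumes "in_hom C f B D" "in_hom C g B D" "in_hom C r A B" "in_hom C s B A"
    and "r \<cdot>\<^bsub>C\<^esub> s = Ident C B" and "f \<cdot>\<^bsub>C\<^esub> r = g \<cdot>\<^bsub>C\<^esub> r"
  shows "f = g"
proof -
  have "f = (f \<cdot>\<^bsub>C\<^esub> r) \<cdot>\<^bsub>C\<^esub> s"
    by (simp only: Comp_assoc_arrow[OF assms(1,3,4)] assms(5) Comp_Ident_arrow[OF assms(1)])
  also have "\<dots> = g"
    by (simp only: assms(6) Comp_assoc_arrow[OF assms(2,3,4)] assms(5) Comp_Ident_arrow[OF assms(2)])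
  finally show ?thesis .
qed

text \<open>Dually, postcompose with the retraction \<open>r\<close>.\<close>

lemma split_mono_cancel:
  assumes "in_hom C f A B" "in_hom C g A B" "in_hom C s B D" "in_hom C r D B"
    and "r \<cdot>\<^bsub>C\<^esub> s = Ident C B" and "s \<cdot>\<^bsub>C\<^esub> f = s \<cdot>\<^bsub>C\<^esub> g"
  shows "f = g"
proof -
  have "f = r \<cdot>\<^bsub>C\<^esub> s \<cdot>\<^bsub>C\<^esub> f"
    by (simp only: Comp_assoc_arrow[OF assms(4,3,1), symmetric] assms(5) Ident_Comp_arrow[OF assms(1)])
  also have "\<dots> = g"
    by (simp only: assms(6) Comp_assoc_arrow[OF assms(4,3,2), symmetric] assms(5)
        Ident_Comp_arrow[OF assms(2)])
  finally show ?thesis .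
qed

text \<open>\<open>inv_arrow\<close> is a definite description, so uniqueness is the point: two
  inverses agree after precomposition with \<open>f\<close>, and \<open>f\<close> is split epi with
  section \<open>g\<close>.\<close>

lemma inv_arrowI:
  assumes "A \<in> Ob C" "B \<in> Ob C" "inverse_arrows C A B f g"
  shows "inv_arrow C A B f = g"
  unfolding inv_arrow_def
proof (rule the_equality)
  fix h assume "inverse_arrows C A B f h"
  then have f: "in_hom C f A B" and g: "in_hom C g B A" and h: "in_hom C h B A"
    and hf: "h \<cdot>\<^bsub>C\<^esub> f = Ident C A" and gf: "g \<cdot>\<^bsub>C\<^esub> f = Ident C A"
    and fg: "f \<cdot>\<^bsub>C\<^esub> g = Ident C B"
    using assms by (auto simp: inverse_arrows_def in_hom_def)
  show "h = g"
    by (rule split_epi_cancel[OF h g f g fg]) (simp only: hf gf)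
qed (rule assms)

lemma iso_arrow_inverse:
  assumes "A \<in> Ob C" "B \<in> Ob C" "iso_arrow C A B f"
  shows "inverse_arrows C A B f (inv_arrow C A B f)"
  using assms inv_arrowI unfolding iso_arrow_def by metis

end

context linear_functor
begin

lemma farr_arrow: "in_hom C f A B \<Longrightarrow> in_hom D (farr T f) (fobj T A) (fobj T B)"
  using farr_linear[of A B] by (auto simp: in_hom_def linear_map_def fobj_closed Pi_iff)

lemma farr_Comp_arrow:
  "\<lbrakk>in_hom C g B E; in_hom C f A B\<rbrakk> \<Longrightarrow> farr T (g \<cdot>\<^bsub>C\<^esub> f) = farr T g \<cdot>\<^bsub>D\<^esub> farr T f"
  unfolding in_hom_def by (elim conjE) (rule farr_Comp[of A B E]; assumption)

end

lemma (in bilinear_functor) ta_arrow: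
  "\<lbrakk>in_hom B f X X'; in_hom C g Y Y'\<rbrakk> \<Longrightarrow> in_hom D (ta f g) (to X Y) (to X' Y')"
  using ta_bilinear[of X X' Y Y']
  by (auto simp: in_hom_def bilinear_map_def linear_map_def to_closed Pi_iff)

lemma (in bilinear_functor) ta_Comp_arrow:
  "\<lbrakk>in_hom B f' X' X''; in_hom B f X X'; in_hom C g' Y' Y''; in_hom C g Y Y'\<rbrakk>
    \<Longrightarrow> ta (f' \<cdot>\<^bsub>B\<^esub> f) (g' \<cdot>\<^bsub>C\<^esub> g) = ta f' g' \<cdot>\<^bsub>D\<^esub> ta f g"
  unfolding in_hom_def by (elim conjE) (rule ta_Comp[of X X' X'' Y Y' Y'']; assumption)

section \<open>Replacing the unit and counit of an adjunction\<close>

text \<open>An abstract form of what the semigroup adjunction supplies. \<open>R_p\<close> and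
  \<open>L_q\<close> distil condition (IV), \<open>p_n\<close> and \<open>e_q\<close> condition
  (III); in the application \<open>p\<close> and \<open>q\<close> come from
  \<open>\<epsilon>r F\<close> and \<open>\<eta>r F'\<close>.\<close>

locale adjunction_correction = adjunction K C D L R \<eta> \<epsilon>
  for K (structure)
    and C :: "('o, 'a, 'k, 'y) lcat_scheme"
    and D :: "('p, 'b, 'k, 'z) lcat_scheme"
    and L :: "('o, 'a, 'p, 'b) fctr"
    and R :: "('p, 'b, 'o, 'a) fctr"
    and \<eta> :: "'o \<Rightarrow> 'a" and \<epsilon> :: "'p \<Rightarrow> 'b" +
  fixes e :: "'p \<Rightarrow> 'a" and n :: "'o \<Rightarrow> 'b" and p :: "'o \<Rightarrow> 'b" and q :: "'p \<Rightarrow> 'a"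
  assumes e_nat: "nat_transf D C (comp_fctr R (comp_fctr L R)) R e"
    and n_nat: "nat_transf C D L (comp_fctr L (comp_fctr R L)) n"
    and p_arrow: "X \<in> Ob C \<Longrightarrow> in_hom D (p X) (fobj L (fobj R (fobj L X))) (fobj L X)"
    and q_arrow: "Y \<in> Ob D \<Longrightarrow> in_hom C (q Y) (fobj R Y) (fobj R (fobj L (fobj R Y)))"
    and R_p: "X \<in> Ob C \<Longrightarrow> farr R (p X) = e (fobj L X)"
    and L_q: "Y \<in> Ob D \<Longrightarrow> farr L (q Y) = n (fobj R Y)"
    and p_n: "X \<in> Ob C \<Longrightarrow> p X \<cdot>\<^bsub>D\<^esub> n X = Ident D (fobj L X)"
    and e_q: "Y \<in> Ob D \<Longrightarrow> e Y \<cdot>\<^bsub>C\<^esub> q Y = Ident C (fobj R Y)"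
begin

text \<open>The adjoint transpose of an endomorphism of \<open>fobj R Y\<close>, namely
  \<open>\<eta> (fobj R Y)\<close> followed by \<open>e Y\<close>.\<close>

definition new_counit :: "'p \<Rightarrow> 'b"
  where "new_counit Y = \<epsilon> Y \<cdot>\<^bsub>D\<^esub> farr L (e Y \<cdot>\<^bsub>C\<^esub> \<eta> (fobj R Y))"

text \<open>The adjoint transpose of an endomorphism of \<open>fobj L X\<close>, namely
  \<open>n X\<close> followed by \<open>\<epsilon> (fobj L X)\<close>.\<close>

definition new_unit :: "'o \<Rightarrow> 'a"
  where "new_unit X = farr R (\<epsilon> (fobj L X) \<cdot>\<^bsub>D\<^esub> n X) \<cdot>\<^bsub>C\<^esub> \<eta> X"

section \<open>Components and naturality squares of the given data\<close>

lemma unit_arrow: "X \<in> Ob C \<Longrightarrow> in_hom C (\<eta> X) X (fobj R (fobj L X))"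
  using unit_nat
  by (auto simp: nat_transf_def id_fctr_def comp_fctr_def in_hom_def L.fobj_closed R.fobj_closed)

lemma counit_arrow: "Y \<in> Ob D \<Longrightarrow> in_hom D (\<epsilon> Y) (fobj L (fobj R Y)) Y"
  using counit_nat
  by (auto simp: nat_transf_def id_fctr_def comp_fctr_def in_hom_def L.fobj_closed R.fobj_closed)

lemma e_arrow: "Y \<in> Ob D \<Longrightarrow> in_hom C (e Y) (fobj R (fobj L (fobj R Y))) (fobj R Y)"
  using e_nat by (auto simp: nat_transf_def comp_fctr_def in_hom_def L.fobj_closed R.fobj_closed)

lemma n_arrow: "X \<in> Ob C \<Longrightarrow> in_hom D (n X) (fobj L X) (fobj L (fobj R (fobj L X)))"
  using n_nat by (auto simp: nat_transf_def comp_fctr_def in_hom_def L.fobj_closed R.fobj_closed)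

lemma unit_natural:
  "in_hom C f X Y \<Longrightarrow> \<eta> Y \<cdot>\<^bsub>C\<^esub> f = farr R (farr L f) \<cdot>\<^bsub>C\<^esub> \<eta> X"
  using unit_nat by (auto simp: nat_transf_def id_fctr_def comp_fctr_def in_hom_def)

lemma counit_natural:
  "in_hom D f X Y \<Longrightarrow> \<epsilon> Y \<cdot>\<^bsub>D\<^esub> farr L (farr R f) = f \<cdot>\<^bsub>D\<^esub> \<epsilon> X"
  using counit_nat by (auto simp: nat_transf_def id_fctr_def comp_fctr_def in_hom_def)

lemma e_natural:
  "in_hom D f X Y \<Longrightarrow> e Y \<cdot>\<^bsub>C\<^esub> farr R (farr L (farr R f)) = farr R f \<cdot>\<^bsub>C\<^esub> e X"
  using e_nat by (auto simp: nat_transf_def comp_fctr_def in_hom_def)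

lemma n_natural:
  "in_hom C f X Y \<Longrightarrow> n Y \<cdot>\<^bsub>D\<^esub> farr L f = farr L (farr R (farr L f)) \<cdot>\<^bsub>D\<^esub> n X"
  using n_nat by (auto simp: nat_transf_def comp_fctr_def in_hom_def)

section \<open>The corrected unit and counit are natural\<close>

lemma new_counit_arrow:
  "Y \<in> Ob D \<Longrightarrow> in_hom D (new_counit Y) (fobj L (fobj R Y)) Y"
  unfolding new_counit_def
  by (rule L.D.Comp_arrow L.farr_arrow L.C.Comp_arrow counit_arrow e_arrow unit_arrow R.fobj_closed
      | assumption)+

lemma new_unit_arrow:
  "X \<in> Ob C \<Longrightarrow> in_hom C (new_unit X) X (fobj R (fobj L X))"
  unfolding new_unit_def
  by (rule L.C.Comp_arrow R.farr_arrow L.D.Comp_arrow counit_arrow n_arrow unit_arrow L.fobj_closed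
      | assumption)+

text \<open>The endomorphism of \<open>R\<close> being transposed is natural, and naturality of
  \<open>\<epsilon>\<close> carries this across the adjunction.\<close>

lemma new_counit_natural:
  assumes f: "in_hom D f X Y"
  shows "new_counit Y \<cdot>\<^bsub>D\<^esub> farr L (farr R f) = f \<cdot>\<^bsub>D\<^esub> new_counit X"
proof -
  have XY: "X \<in> Ob D" "Y \<in> Ob D"
    using f by (auto simp: in_hom_def)
  note R = R.farr_arrow[OF f] and LR = L.farr_arrow[OF R.farr_arrow[OF f]]
  note RLR = R.farr_arrow[OF LR]
  note \<eta>X = unit_arrow[OF R.fobj_closed[OF XY(1)]] and \<eta>Y = unit_arrow[OF R.fobj_closed[OF XY(2)]]
  note eX = e_arrow[OF XY(1)] and eY = e_arrow[OF XY(2)]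
  note cX = L.C.Comp_arrow[OF eX \<eta>X] and cY = L.C.Comp_arrow[OF eY \<eta>Y]
  note \<epsilon>X = counit_arrow[OF XY(1)] and \<epsilon>Y = counit_arrow[OF XY(2)]
  \<comment> \<open>The endomorphism commutes with \<open>farr R f\<close>: naturality of
    \<open>\<eta>\<close> at \<open>farr R f\<close>, then of \<open>e\<close> at
    \<open>f\<close>.\<close>
  have c: "(e Y \<cdot>\<^bsub>C\<^esub> \<eta> (fobj R Y)) \<cdot>\<^bsub>C\<^esub> farr R f = farr R f \<cdot>\<^bsub>C\<^esub> e X \<cdot>\<^bsub>C\<^esub> \<eta> (fobj R X)"
    using L.C.Comp_assoc_arrow[OF eY \<eta>Y R] L.C.Comp_assoc_arrow[OF eY RLR \<eta>X]
      L.C.Comp_assoc_arrow[OF R eX \<eta>X] unit_natural[OF R] e_natural[OF f] by simp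
  have "new_counit Y \<cdot>\<^bsub>D\<^esub> farr L (farr R f)
      = \<epsilon> Y \<cdot>\<^bsub>D\<^esub> farr L ((e Y \<cdot>\<^bsub>C\<^esub> \<eta> (fobj R Y)) \<cdot>\<^bsub>C\<^esub> farr R f)"
    unfolding new_counit_def
    using L.D.Comp_assoc_arrow[OF \<epsilon>Y L.farr_arrow[OF cY] LR] L.farr_Comp_arrow[OF cY R] by simp
  also have "\<dots> = (\<epsilon> Y \<cdot>\<^bsub>D\<^esub> farr L (farr R f)) \<cdot>\<^bsub>D\<^esub> farr L (e X \<cdot>\<^bsub>C\<^esub> \<eta> (fobj R X))"
    unfolding c using L.D.Comp_assoc_arrow[OF \<epsilon>Y LR L.farr_arrow[OF cX]] L.farr_Comp_arrow[OF R cX]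
    by simp
  also have "\<dots> = f \<cdot>\<^bsub>D\<^esub> new_counit X"
    unfolding new_counit_def counit_natural[OF f]
    by (rule L.D.Comp_assoc_arrow[OF f \<epsilon>X L.farr_arrow[OF cX]])
  finally show ?thesis .
qed

lemma new_unit_natural:
  assumes f: "in_hom C f X Y"
  shows "new_unit Y \<cdot>\<^bsub>C\<^esub> f = farr R (farr L f) \<cdot>\<^bsub>C\<^esub> new_unit X"
proof -
  have XY: "X \<in> Ob C" "Y \<in> Ob C"
    using f by (auto simp: in_hom_def)
  note L = L.farr_arrow[OF f] and RL = R.farr_arrow[OF L.farr_arrow[OF f]]
  note LRL = L.farr_arrow[OF RL]
  note \<epsilon>X = counit_arrow[OF L.fobj_closed[OF XY(1)]]
    and \<epsilon>Y = counit_arrow[OF L.fobj_closed[OF XY(2)]]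
  note nX = n_arrow[OF XY(1)] and nY = n_arrow[OF XY(2)]
  note cX = L.D.Comp_arrow[OF \<epsilon>X nX] and cY = L.D.Comp_arrow[OF \<epsilon>Y nY]
  note \<eta>X = unit_arrow[OF XY(1)] and \<eta>Y = unit_arrow[OF XY(2)]
  \<comment> \<open>The endomorphism of \<open>L\<close> before transposition is natural: first
    naturality of \<open>n\<close>, then of \<open>\<epsilon>\<close>.\<close>
  have c: "(\<epsilon> (fobj L Y) \<cdot>\<^bsub>D\<^esub> n Y) \<cdot>\<^bsub>D\<^esub> farr L f = farr L f \<cdot>\<^bsub>D\<^esub> \<epsilon> (fobj L X) \<cdot>\<^bsub>D\<^esub> n X"
    using L.D.Comp_assoc_arrow[OF \<epsilon>Y nY L] L.D.Comp_assoc_arrow[OF \<epsilon>Y LRL nX]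
      L.D.Comp_assoc_arrow[OF L \<epsilon>X nX] counit_natural[OF L] n_natural[OF f] by simp
  have "new_unit Y \<cdot>\<^bsub>C\<^esub> f = farr R (\<epsilon> (fobj L Y) \<cdot>\<^bsub>D\<^esub> n Y) \<cdot>\<^bsub>C\<^esub> farr R (farr L f) \<cdot>\<^bsub>C\<^esub> \<eta> X"
    unfolding new_unit_def unit_natural[OF f, symmetric]
    by (rule L.C.Comp_assoc_arrow[OF R.farr_arrow[OF cY] \<eta>Y f])
  also have "\<dots> = farr R ((\<epsilon> (fobj L Y) \<cdot>\<^bsub>D\<^esub> n Y) \<cdot>\<^bsub>D\<^esub> farr L f) \<cdot>\<^bsub>C\<^esub> \<eta> X"
    using L.C.Comp_assoc_arrow[OF R.farr_arrow[OF cY] RL \<eta>X] R.farr_Comp_arrow[OF cY L] by simp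
  also have "\<dots> = farr R (farr L f) \<cdot>\<^bsub>C\<^esub> new_unit X"
    unfolding c new_unit_def
    using L.C.Comp_assoc_arrow[OF RL R.farr_arrow[OF cX] \<eta>X] R.farr_Comp_arrow[OF L cX] by simp
  finally show ?thesis .
qed

text \<open>On the image of \<open>L\<close>, \<open>R_p\<close> replaces \<open>e\<close> by
  \<open>farr R (p X)\<close>. Naturality of \<open>\<epsilon>\<close> at \<open>p X\<close> pulls
  \<open>p X\<close> out to the left, and what remains is the triangle identity for \<open>L\<close>
  at \<open>fobj R (fobj L X)\<close>.\<close>

lemma new_counit_L:
  assumes X: "X \<in> Ob C"
  shows "new_counit (fobj L X) = p X"
proof -
  let ?Y = "fobj R (fobj L X)"
  have Y: "fobj L X \<in> Ob D" "?Y \<in> Ob C"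
    using X by (auto intro: L.fobj_closed R.fobj_closed)
  note P = p_arrow[OF X]
  note \<eta> = unit_arrow[OF Y(2)] and \<epsilon> = counit_arrow[OF Y(1)]
    and \<epsilon>' = counit_arrow[OF L.fobj_closed[OF Y(2)]]
  have "new_counit (fobj L X) = (\<epsilon> (fobj L X) \<cdot>\<^bsub>D\<^esub> farr L (farr R (p X))) \<cdot>\<^bsub>D\<^esub> farr L (\<eta> ?Y)"
    unfolding new_counit_def R_p[OF X, symmetric]
    using L.D.Comp_assoc_arrow[OF \<epsilon> L.farr_arrow[OF R.farr_arrow[OF P]] L.farr_arrow[OF \<eta>]]
      L.farr_Comp_arrow[OF R.farr_arrow[OF P] \<eta>] by simp
  also have "\<dots> = p X \<cdot>\<^bsub>D\<^esub> Ident D (fobj L ?Y)"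
    using L.D.Comp_assoc_arrow[OF P \<epsilon>' L.farr_arrow[OF \<eta>]] counit_natural[OF P] triangle_L[OF Y(2)]
    by simp
  finally show ?thesis
    using L.D.Comp_Ident_arrow[OF P] by simp
qed

text \<open>Dual: \<open>L_q\<close> replaces \<open>n\<close> by \<open>farr L (q Y)\<close>,
  naturality of \<open>\<eta>\<close> at \<open>q Y\<close> pulls \<open>q Y\<close> out to the
  right, and the triangle identity for \<open>R\<close> removes the rest.\<close>

lemma new_unit_R:
  assumes Y: "Y \<in> Ob D"
  shows "new_unit (fobj R Y) = q Y"
proof -
  let ?X = "fobj L (fobj R Y)"
  have X: "fobj R Y \<in> Ob C" "?X \<in> Ob D"
    using Y by (auto intro: L.fobj_closed R.fobj_closed)
  note Q = q_arrow[OF Y]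
  note \<eta> = unit_arrow[OF X(1)] and \<epsilon> = counit_arrow[OF X(2)]
    and \<eta>' = unit_arrow[OF R.fobj_closed[OF X(2)]]
  have "new_unit (fobj R Y) = farr R (\<epsilon> ?X) \<cdot>\<^bsub>C\<^esub> farr R (farr L (q Y)) \<cdot>\<^bsub>C\<^esub> \<eta> (fobj R Y)"
    unfolding new_unit_def L_q[OF Y, symmetric]
    using L.C.Comp_assoc_arrow[OF R.farr_arrow[OF \<epsilon>] R.farr_arrow[OF L.farr_arrow[OF Q]] \<eta>]
      R.farr_Comp_arrow[OF \<epsilon> L.farr_arrow[OF Q]] by simp
  also have "\<dots> = Ident C (fobj R ?X) \<cdot>\<^bsub>C\<^esub> q Y"
    using L.C.Comp_assoc_arrow[OF R.farr_arrow[OF \<epsilon>] \<eta>' Q] unit_natural[OF Q] triangle_R[OF X(2)]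
    by simp
  finally show ?thesis
    using L.C.Ident_Comp_arrow[OF Q] by simp
qed

text \<open>Both sides are natural and agree on the image of \<open>L\<close>, where the new counit
  is \<open>p\<close>. Naturality along \<open>\<epsilon> Y\<close>, which starts in that image,
  extends the agreement to \<open>Y\<close>. The functor \<open>H\<close> is arbitrary because two
  cases are needed: \<open>R\<close> for a triangle identity, and the actions of all objects of
  \<open>S\<close> for the compatibility equations.\<close>

lemma farr_new_counit:
  assumes H: "linear_functor K D E H"
    and g: "nat_transf D E (comp_fctr H (comp_fctr L R)) H g"
    and gL: "\<And>X. X \<in> Ob C \<Longrightarrow> farr H (p X) = g (fobj L X)"
    and Y: "Y \<in> Ob D"
  shows "farr H (new_counit Y) = g Y"
proof -
  interpret H: linear_functor K D E H
    by (rule H)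
  have RY: "fobj R Y \<in> Ob C" and LRY: "fobj L (fobj R Y) \<in> Ob D"
    using Y by (auto intro: L.fobj_closed R.fobj_closed)
  note \<epsilon> = counit_arrow[OF Y] and \<eta> = unit_arrow[OF RY]
  note LR\<epsilon> = L.farr_arrow[OF R.farr_arrow[OF \<epsilon>]]
  have gY: "in_hom E (g Y) (fobj H (fobj L (fobj R Y))) (fobj H Y)"
    using g Y LRY by (auto simp: nat_transf_def comp_fctr_def in_hom_def H.fobj_closed)
  have g_nat: "g Y \<cdot>\<^bsub>E\<^esub> farr H (farr L (farr R (\<epsilon> Y))) = farr H (\<epsilon> Y) \<cdot>\<^bsub>E\<^esub> g (fobj L (fobj R Y))"
    using g \<epsilon> by (auto simp: nat_transf_def comp_fctr_def in_hom_def)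
  \<comment> \<open>The image under \<open>L\<close> of a triangle identity; \<open>H\<close> then
    preserves the splitting.\<close>
  have "farr L (farr R (\<epsilon> Y)) \<cdot>\<^bsub>D\<^esub> farr L (\<eta> (fobj R Y)) = Ident D (fobj L (fobj R Y))"
    using L.farr_Comp_arrow[OF R.farr_arrow[OF \<epsilon>] \<eta>] triangle_R[OF Y] L.farr_Ident[OF RY] by simp
  then have split: "farr H (farr L (farr R (\<epsilon> Y))) \<cdot>\<^bsub>E\<^esub> farr H (farr L (\<eta> (fobj R Y)))
      = Ident E (fobj H (fobj L (fobj R Y)))"
    using H.farr_Comp_arrow[OF LR\<epsilon> L.farr_arrow[OF \<eta>]] H.farr_Ident[OF LRY] by simp
  \<comment> \<open>Naturality along \<open>\<epsilon> Y\<close> moves the new counit to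
    \<open>fobj L (fobj R Y)\<close>, where it is known.\<close>
  have "farr H (new_counit Y) \<cdot>\<^bsub>E\<^esub> farr H (farr L (farr R (\<epsilon> Y)))
      = farr H (\<epsilon> Y \<cdot>\<^bsub>D\<^esub> new_counit (fobj L (fobj R Y)))"
    using H.farr_Comp_arrow[OF new_counit_arrow[OF Y] LR\<epsilon>] new_counit_natural[OF \<epsilon>] by simp
  also have "\<dots> = g Y \<cdot>\<^bsub>E\<^esub> farr H (farr L (farr R (\<epsilon> Y)))"
    using H.farr_Comp_arrow[OF \<epsilon> new_counit_arrow[OF LRY]] new_counit_L[OF RY] gL[OF RY] g_nat
    by simp
  finally show ?thesis
    by (rule H.D.split_epi_cancel[OF H.farr_arrow[OF new_counit_arrow[OF Y]] gY
          H.farr_arrow[OF LR\<epsilon>] H.farr_arrow[OF L.farr_arrow[OF \<eta>]] split])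
qed

text \<open>Dual: compare along \<open>\<eta> X\<close>, whose target lies in the image of
  \<open>R\<close>, and cancel the split monomorphism \<open>farr R (farr L (\<eta> X))\<close>,
  which has retraction \<open>farr R (\<epsilon> (fobj L X))\<close>.\<close>

lemma farr_new_unit:
  assumes H: "linear_functor K C E H"
    and g: "nat_transf C E H (comp_fctr H (comp_fctr R L)) g"
    and gR: "\<And>Y. Y \<in> Ob D \<Longrightarrow> farr H (q Y) = g (fobj R Y)"
    and X: "X \<in> Ob C"
  shows "farr H (new_unit X) = g X"
proof -
  interpret H: linear_functor K C E H
    by (rule H)
  have LX: "fobj L X \<in> Ob D" and RLX: "fobj R (fobj L X) \<in> Ob C"
    using X by (auto intro: L.fobj_closed R.fobj_closed)
  note \<eta> = unit_arrow[OF X] and \<epsilon> = counit_arrow[OF LX]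
  note RL\<eta> = R.farr_arrow[OF L.farr_arrow[OF \<eta>]]
  have gX: "in_hom E (g X) (fobj H X) (fobj H (fobj R (fobj L X)))"
    using g X RLX by (auto simp: nat_transf_def comp_fctr_def in_hom_def H.fobj_closed)
  have g_nat: "g (fobj R (fobj L X)) \<cdot>\<^bsub>E\<^esub> farr H (\<eta> X) = farr H (farr R (farr L (\<eta> X))) \<cdot>\<^bsub>E\<^esub> g X"
    using g \<eta> by (auto simp: nat_transf_def comp_fctr_def in_hom_def)
  have "farr R (\<epsilon> (fobj L X)) \<cdot>\<^bsub>C\<^esub> farr R (farr L (\<eta> X)) = Ident C (fobj R (fobj L X))"
    using R.farr_Comp_arrow[OF \<epsilon> L.farr_arrow[OF \<eta>]] triangle_L[OF X] R.farr_Ident[OF LX] by simp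
  then have split: "farr H (farr R (\<epsilon> (fobj L X))) \<cdot>\<^bsub>E\<^esub> farr H (farr R (farr L (\<eta> X)))
      = Ident E (fobj H (fobj R (fobj L X)))"
    using H.farr_Comp_arrow[OF R.farr_arrow[OF \<epsilon>] RL\<eta>] H.farr_Ident[OF RLX] by simp
  have "farr H (farr R (farr L (\<eta> X))) \<cdot>\<^bsub>E\<^esub> farr H (new_unit X)
      = farr H (new_unit (fobj R (fobj L X)) \<cdot>\<^bsub>C\<^esub> \<eta> X)"
    using H.farr_Comp_arrow[OF RL\<eta> new_unit_arrow[OF X]] new_unit_natural[OF \<eta>] by simp
  also have "\<dots> = farr H (farr R (farr L (\<eta> X))) \<cdot>\<^bsub>E\<^esub> g X"
    using H.farr_Comp_arrow[OF new_unit_arrow[OF RLX] \<eta>] new_unit_R[OF LX] gR[OF LX] g_nat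
    by simp
  finally show ?thesis
    by (rule H.D.split_mono_cancel[OF H.farr_arrow[OF new_unit_arrow[OF X]] gX
          H.farr_arrow[OF RL\<eta>] H.farr_arrow[OF R.farr_arrow[OF \<epsilon>]] split])
qed

lemma new_adjunction: "adjunction K C D L R new_unit new_counit"
proof
  show "nat_transf C C id_fctr (comp_fctr R L) new_unit"
    using new_unit_arrow new_unit_natural
    by (auto simp: nat_transf_def id_fctr_def comp_fctr_def in_hom_def)
  show "nat_transf D D (comp_fctr L R) id_fctr new_counit"
    using new_counit_arrow new_counit_natural
    by (auto simp: nat_transf_def id_fctr_def comp_fctr_def in_hom_def)
  \<comment> \<open>With \<open>H = L\<close> and \<open>g = n\<close>, \<open>farr_new_unit\<close>
    identifies \<open>farr L (new_unit X)\<close> with \<open>n X\<close>. As the new counit at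
    \<open>fobj L X\<close> is \<open>p X\<close>, the triangle is \<open>p_n\<close>; the other one
    reduces to \<open>e_q\<close> in the same way.\<close>
  show "new_counit (fobj L X) \<cdot>\<^bsub>D\<^esub> farr L (new_unit X) = Ident D (fobj L X)" if "X \<in> Ob C" for X
    using farr_new_unit[OF L.linear_functor_axioms n_nat L_q that] new_counit_L[OF that] p_n[OF that]
    by simp
  show "farr R (new_counit Y) \<cdot>\<^bsub>C\<^esub> new_unit (fobj R Y) = Ident C (fobj R Y)" if "Y \<in> Ob D" for Y
    using farr_new_counit[OF R.linear_functor_axioms e_nat R_p that] new_unit_R[OF that] e_q[OF that]
    by simp
qed

end

section \<open>Sources and targets\<close>

text \<open>With the sources and targets as functions, the typing conditions of associativity
  contain no object variables besides the arrows, so they are within reach of the simplifier.\<close>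

definition is_arrow :: "('o, 'a, 'k, 'z) lcat_scheme \<Rightarrow> 'a \<Rightarrow> bool"
  where "is_arrow C f \<longleftrightarrow> (\<exists>A B. in_hom C f A B)"

definition source :: "('o, 'a, 'k, 'z) lcat_scheme \<Rightarrow> 'a \<Rightarrow> 'o"
  where "source C f = (THE A. \<exists>B. in_hom C f A B)"

definition target :: "('o, 'a, 'k, 'z) lcat_scheme \<Rightarrow> 'a \<Rightarrow> 'o"
  where "target C f = (THE B. \<exists>A. in_hom C f A B)"

context linear_category
begin

lemma in_hom_unique: "\<lbrakk>in_hom C f A B; in_hom C f A' B'\<rbrakk> \<Longrightarrow> A = A' \<and> B = B'"
  unfolding in_hom_def by (elim conjE) (rule Hom_disjoint[of A B A' B' f]; assumption)

text \<open>Disjointness of hom-sets makes the two definite descriptions well defined. Typing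
  judgements thereby become equations that can be used for rewriting.\<close>

lemma in_hom_iff: "in_hom C f A B \<longleftrightarrow> is_arrow C f \<and> source C f = A \<and> target C f = B"
proof
  assume f: "in_hom C f A B"
  then show "is_arrow C f \<and> source C f = A \<and> target C f = B"
    using in_hom_unique[OF f] unfolding is_arrow_def source_def target_def by blast
next
  assume f: "is_arrow C f \<and> source C f = A \<and> target C f = B"
  then obtain A' B' where f': "in_hom C f A' B'"
    unfolding is_arrow_def by blast
  then have "source C f = A'" "target C f = B'"
    using in_hom_unique[OF f'] unfolding source_def target_def by blast+
  then show "in_hom C f A B"
    using f f' by blast
qed

lemma is_arrow_in_hom: "is_arrow C f \<Longrightarrow> in_hom C f (source C f) (target C f)"
  by (simp add: in_hom_iff)

lemma Ident_simps:
  "A \<in> Ob C \<Longrightarrow> is_arrow C (Ident C A)"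
  "A \<in> Ob C \<Longrightarrow> source C (Ident C A) = A"
  "A \<in> Ob C \<Longrightarrow> target C (Ident C A) = A"
  using Ident_arrow[of A] by (simp_all add: in_hom_iff)

lemma Comp_simps:
  assumes "is_arrow C g" "is_arrow C f" "source C g = target C f"
  shows "is_arrow C (g \<cdot>\<^bsub>C\<^esub> f)" "source C (g \<cdot>\<^bsub>C\<^esub> f) = source C f"
    "target C (g \<cdot>\<^bsub>C\<^esub> f) = target C g"
  using Comp_arrow[of g "source C g" "target C g" f "source C f"] assms
  by (simp_all add: in_hom_iff)

lemma Comp_Ident_source: "\<lbrakk>is_arrow C f; source C f = A\<rbrakk> \<Longrightarrow> f \<cdot>\<^bsub>C\<^esub> Ident C A = f"
  by (rule Comp_Ident_arrow[of f A "target C f"]) (simp add: in_hom_iff)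

lemma Ident_target_Comp: "\<lbrakk>is_arrow C f; target C f = B\<rbrakk> \<Longrightarrow> Ident C B \<cdot>\<^bsub>C\<^esub> f = f"
  by (rule Ident_Comp_arrow[of f "source C f" B]) (simp add: in_hom_iff)

lemma Comp_assoc_source_target:
  "\<lbrakk>is_arrow C h; is_arrow C g; is_arrow C f; source C h = target C g; source C g = target C f\<rbrakk>
    \<Longrightarrow> (h \<cdot>\<^bsub>C\<^esub> g) \<cdot>\<^bsub>C\<^esub> f = h \<cdot>\<^bsub>C\<^esub> g \<cdot>\<^bsub>C\<^esub> f"
  by (rule Comp_assoc_arrow[of h "target C g" "target C h" g "target C f" f "source C f"])
    (simp_all add: in_hom_iff)

lemmas arrow_simps = Ident_simps Comp_simps Comp_Ident_source Ident_target_Comp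
  Comp_assoc_source_target

end

context bilinear_functor
begin

lemma ta_simps:
  assumes "is_arrow B f" "is_arrow C g"
  shows "is_arrow D (ta f g)" "source D (ta f g) = to (source B f) (source C g)"
    "target D (ta f g) = to (target B f) (target C g)"
  using ta_arrow[OF B.is_arrow_in_hom[OF assms(1)] C.is_arrow_in_hom[OF assms(2)]]
  by (simp_all add: D.in_hom_iff)

text \<open>Oriented so that rewriting merges a composite of two products into one product of
  composites.\<close>

lemma ta_interchange:
  assumes "is_arrow B f'" "is_arrow B f" "source B f' = target B f"
    and "is_arrow C g'" "is_arrow C g" "source C g' = target C g"
  shows "ta f' g' \<cdot>\<^bsub>D\<^esub> ta f g = ta (f' \<cdot>\<^bsub>B\<^esub> f) (g' \<cdot>\<^bsub>C\<^esub> g)"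
  by (rule ta_Comp_arrow[of f' "target B f" "target B f'" f "source B f"
        g' "target C g" "target C g'" g "source C g", symmetric])
    (simp_all add: assms B.in_hom_iff C.in_hom_iff)

end

section \<open>Coherence in a module category\<close>

context semigroup_module_category
begin

definition act_assoc_inv :: "'s \<Rightarrow> 's \<Rightarrow> 'o \<Rightarrow> 'a"
  where "act_assoc_inv G F X
    = inv_arrow M ((G \<boxtimes>\<^bsub>S\<^esub> F) \<star>\<^bsub>M\<^esub> X) (G \<star>\<^bsub>M\<^esub> F \<star>\<^bsub>M\<^esub> X) (act_assoc M G F X)"

lemma act_assoc_inverse:
  assumes "G \<in> Ob S" "F \<in> Ob S" "X \<in> Ob M"
  shows "inverse_arrows M ((G \<boxtimes>\<^bsub>S\<^esub> F) \<star>\<^bsub>M\<^esub> X) (G \<star>\<^bsub>M\<^esub> F \<star>\<^bsub>M\<^esub> X)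
    (act_assoc M G F X) (act_assoc_inv G F X)"
  unfolding act_assoc_inv_def
  by (rule C.iso_arrow_inverse) (simp_all add: assms to_closed S.to_closed act_assoc_iso)

lemma act_assoc_simps:
  assumes "G \<in> Ob S" "F \<in> Ob S" "X \<in> Ob M"
  shows "is_arrow M (act_assoc M G F X)"
    and "source M (act_assoc M G F X) = (G \<boxtimes>\<^bsub>S\<^esub> F) \<star>\<^bsub>M\<^esub> X"
    and "target M (act_assoc M G F X) = G \<star>\<^bsub>M\<^esub> F \<star>\<^bsub>M\<^esub> X"
    and "is_arrow M (act_assoc_inv G F X)"
    and "source M (act_assoc_inv G F X) = G \<star>\<^bsub>M\<^esub> F \<star>\<^bsub>M\<^esub> X"
    and "target M (act_assoc_inv G F X) = (G \<boxtimes>\<^bsub>S\<^esub> F) \<star>\<^bsub>M\<^esub> X"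
    and "act_assoc_inv G F X \<cdot>\<^bsub>M\<^esub> act_assoc M G F X = Ident M ((G \<boxtimes>\<^bsub>S\<^esub> F) \<star>\<^bsub>M\<^esub> X)"
    and "act_assoc M G F X \<cdot>\<^bsub>M\<^esub> act_assoc_inv G F X = Ident M (G \<star>\<^bsub>M\<^esub> F \<star>\<^bsub>M\<^esub> X)"
proof -
  have ob: "(G \<boxtimes>\<^bsub>S\<^esub> F) \<star>\<^bsub>M\<^esub> X \<in> Ob M" "G \<star>\<^bsub>M\<^esub> F \<star>\<^bsub>M\<^esub> X \<in> Ob M"
    using assms by (simp_all add: to_closed S.to_closed)
  note inv = act_assoc_inverse[OF assms, unfolded inverse_arrows_def]
  have "in_hom M (act_assoc M G F X) ((G \<boxtimes>\<^bsub>S\<^esub> F) \<star>\<^bsub>M\<^esub> X) (G \<star>\<^bsub>M\<^esub> F \<star>\<^bsub>M\<^esub> X)"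
    and "in_hom M (act_assoc_inv G F X) (G \<star>\<^bsub>M\<^esub> F \<star>\<^bsub>M\<^esub> X) ((G \<boxtimes>\<^bsub>S\<^esub> F) \<star>\<^bsub>M\<^esub> X)"
    using inv ob by (blast intro: in_homI)+
  then show "is_arrow M (act_assoc M G F X)"
    and "source M (act_assoc M G F X) = (G \<boxtimes>\<^bsub>S\<^esub> F) \<star>\<^bsub>M\<^esub> X"
    and "target M (act_assoc M G F X) = G \<star>\<^bsub>M\<^esub> F \<star>\<^bsub>M\<^esub> X"
    and "is_arrow M (act_assoc_inv G F X)"
    and "source M (act_assoc_inv G F X) = G \<star>\<^bsub>M\<^esub> F \<star>\<^bsub>M\<^esub> X"
    and "target M (act_assoc_inv G F X) = (G \<boxtimes>\<^bsub>S\<^esub> F) \<star>\<^bsub>M\<^esub> X"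
    unfolding C.in_hom_iff by blast+
  show "act_assoc_inv G F X \<cdot>\<^bsub>M\<^esub> act_assoc M G F X = Ident M ((G \<boxtimes>\<^bsub>S\<^esub> F) \<star>\<^bsub>M\<^esub> X)"
    and "act_assoc M G F X \<cdot>\<^bsub>M\<^esub> act_assoc_inv G F X = Ident M (G \<star>\<^bsub>M\<^esub> F \<star>\<^bsub>M\<^esub> X)"
    using inv by blast+
qed

lemma assoc_simps:
  assumes "A \<in> Ob S" "B \<in> Ob S" "D \<in> Ob S"
  shows "is_arrow S (assoc S A B D)"
    and "source S (assoc S A B D) = A \<boxtimes>\<^bsub>S\<^esub> B \<boxtimes>\<^bsub>S\<^esub> D"
    and "target S (assoc S A B D) = A \<boxtimes>\<^bsub>S\<^esub> (B \<boxtimes>\<^bsub>S\<^esub> D)"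
    and "is_arrow S (inv_assoc S A B D)"
    and "source S (inv_assoc S A B D) = A \<boxtimes>\<^bsub>S\<^esub> (B \<boxtimes>\<^bsub>S\<^esub> D)"
    and "target S (inv_assoc S A B D) = A \<boxtimes>\<^bsub>S\<^esub> B \<boxtimes>\<^bsub>S\<^esub> D"
    and "assoc S A B D \<cdot>\<^bsub>S\<^esub> inv_assoc S A B D = Ident S (A \<boxtimes>\<^bsub>S\<^esub> (B \<boxtimes>\<^bsub>S\<^esub> D))"
proof -
  have ob: "A \<boxtimes>\<^bsub>S\<^esub> B \<boxtimes>\<^bsub>S\<^esub> D \<in> Ob S" "A \<boxtimes>\<^bsub>S\<^esub> (B \<boxtimes>\<^bsub>S\<^esub> D) \<in> Ob S"
    using assms by (simp_all add: S.to_closed)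
  note inv = S.B.iso_arrow_inverse[OF ob S.assoc_iso[OF assms], unfolded inverse_arrows_def]
  have "in_hom S (assoc S A B D) (A \<boxtimes>\<^bsub>S\<^esub> B \<boxtimes>\<^bsub>S\<^esub> D) (A \<boxtimes>\<^bsub>S\<^esub> (B \<boxtimes>\<^bsub>S\<^esub> D))"
    and "in_hom S (inv_assoc S A B D) (A \<boxtimes>\<^bsub>S\<^esub> (B \<boxtimes>\<^bsub>S\<^esub> D)) (A \<boxtimes>\<^bsub>S\<^esub> B \<boxtimes>\<^bsub>S\<^esub> D)"
    using inv ob by (blast intro: in_homI)+
  then show "is_arrow S (assoc S A B D)"
    and "source S (assoc S A B D) = A \<boxtimes>\<^bsub>S\<^esub> B \<boxtimes>\<^bsub>S\<^esub> D"
    and "target S (assoc S A B D) = A \<boxtimes>\<^bsub>S\<^esub> (B \<boxtimes>\<^bsub>S\<^esub> D)"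
    and "is_arrow S (inv_assoc S A B D)"
    and "source S (inv_assoc S A B D) = A \<boxtimes>\<^bsub>S\<^esub> (B \<boxtimes>\<^bsub>S\<^esub> D)"
    and "target S (inv_assoc S A B D) = A \<boxtimes>\<^bsub>S\<^esub> B \<boxtimes>\<^bsub>S\<^esub> D"
    unfolding S.B.in_hom_iff by blast+
  show "assoc S A B D \<cdot>\<^bsub>S\<^esub> inv_assoc S A B D = Ident S (A \<boxtimes>\<^bsub>S\<^esub> (B \<boxtimes>\<^bsub>S\<^esub> D))"
    using inv by blast
qed

text \<open>Composites are normalised to the right, so inverse pairs usually occur in front of a
  tail \<open>z\<close>.\<close>

lemma act_assoc_cancel:
  assumes "G \<in> Ob S" "F \<in> Ob S" "X \<in> Ob M" "is_arrow M z"
  shows "target M z = (G \<boxtimes>\<^bsub>S\<^esub> F) \<star>\<^bsub>M\<^esub> X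
      \<Longrightarrow> act_assoc_inv G F X \<cdot>\<^bsub>M\<^esub> act_assoc M G F X \<cdot>\<^bsub>M\<^esub> z = z"
    and "target M z = G \<star>\<^bsub>M\<^esub> F \<star>\<^bsub>M\<^esub> X
      \<Longrightarrow> act_assoc M G F X \<cdot>\<^bsub>M\<^esub> act_assoc_inv G F X \<cdot>\<^bsub>M\<^esub> z = z"
  using assms by (simp_all add: C.Comp_assoc_source_target[symmetric] act_assoc_simps
      C.Ident_target_Comp)

lemma ta_interchange_Comp:
  assumes "is_arrow S f'" "is_arrow S f" "source S f' = target S f"
    and "is_arrow M g'" "is_arrow M g" "source M g' = target M g"
    and "is_arrow M z" "target M z = source S f \<star>\<^bsub>M\<^esub> source M g"
  shows "(f' \<star>\<^sub>m\<^bsub>M\<^esub> g') \<cdot>\<^bsub>M\<^esub> (f \<star>\<^sub>m\<^bsub>M\<^esub> g) \<cdot>\<^bsub>M\<^esub> z = ((f' \<cdot>\<^bsub>S\<^esub> f) \<star>\<^sub>m\<^bsub>M\<^esub> (g' \<cdot>\<^bsub>M\<^esub> g)) \<cdot>\<^bsub>M\<^esub> z"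
  using assms by (simp add: C.Comp_assoc_source_target[symmetric] ta_simps ta_interchange)

text \<open>A normalisation: nest composites to the right, merge neighbouring products and actions,
  cancel inverse associators. Naturality of associators and \<open>act_coherence\<close> stay
  outside; the proofs below bracket the relevant subterm and unfold these by hand.\<close>

lemmas coherence_simps = S.B.arrow_simps C.arrow_simps S.ta_simps ta_simps act_assoc_simps
  assoc_simps S.to_closed to_closed S.ta_interchange ta_interchange S.ta_Ident ta_Ident
  act_assoc_cancel ta_interchange_Comp

lemma act_assoc_natural_arrow:
  assumes "in_hom S g G G'" "in_hom S f F F'" "in_hom M x X X'"
  shows "act_assoc M G' F' X' \<cdot>\<^bsub>M\<^esub> ((g \<boxtimes>\<^sub>m\<^bsub>S\<^esub> f) \<star>\<^sub>m\<^bsub>M\<^esub> x)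
    = (g \<star>\<^sub>m\<^bsub>M\<^esub> f \<star>\<^sub>m\<^bsub>M\<^esub> x) \<cdot>\<^bsub>M\<^esub> act_assoc M G F X"
  using assms unfolding in_hom_def by (elim conjE) (rule act_assoc_natural; assumption)

text \<open>Insert \<open>act_assoc\<close> and its inverse at the source, apply the naturality
  square of \<open>act_assoc\<close>, and cancel at the target.\<close>

lemma act_assoc_inv_natural:
  assumes g: "in_hom S g G G'" and f: "in_hom S f F F'" and x: "in_hom M x X X'"
  shows "act_assoc_inv G' F' X' \<cdot>\<^bsub>M\<^esub> (g \<star>\<^sub>m\<^bsub>M\<^esub> f \<star>\<^sub>m\<^bsub>M\<^esub> x)
    = ((g \<boxtimes>\<^sub>m\<^bsub>S\<^esub> f) \<star>\<^sub>m\<^bsub>M\<^esub> x) \<cdot>\<^bsub>M\<^esub> act_assoc_inv G F X"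
proof -
  have ob: "G \<in> Ob S" "G' \<in> Ob S" "F \<in> Ob S" "F' \<in> Ob S" "X \<in> Ob M" "X' \<in> Ob M"
    using g f x by (simp_all add: in_hom_def)
  note t = g[unfolded S.B.in_hom_iff] f[unfolded S.B.in_hom_iff] x[unfolded C.in_hom_iff]
  have "act_assoc_inv G' F' X' \<cdot>\<^bsub>M\<^esub> (g \<star>\<^sub>m\<^bsub>M\<^esub> f \<star>\<^sub>m\<^bsub>M\<^esub> x)
    = act_assoc_inv G' F' X' \<cdot>\<^bsub>M\<^esub> ((g \<star>\<^sub>m\<^bsub>M\<^esub> f \<star>\<^sub>m\<^bsub>M\<^esub> x) \<cdot>\<^bsub>M\<^esub> act_assoc M G F X)
        \<cdot>\<^bsub>M\<^esub> act_assoc_inv G F X"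
    by (simp add: coherence_simps ob t)
  also have "\<dots> = ((g \<boxtimes>\<^sub>m\<^bsub>S\<^esub> f) \<star>\<^sub>m\<^bsub>M\<^esub> x) \<cdot>\<^bsub>M\<^esub> act_assoc_inv G F X"
    unfolding act_assoc_natural_arrow[OF g f x, symmetric]
    by (simp add: coherence_simps ob t)
  finally show ?thesis .
qed

text \<open>The values of \<open>H \<star> \<epsilon>\<^sub>X\<close> and \<open>H \<star> \<eta>\<^sub>X\<close> that respecting an adjunction prescribes, for
  \<open>l = \<epsilon>l H\<close> and \<open>l = \<eta>l H\<close>.\<close>

definition counit_at :: "'s \<Rightarrow> 's \<Rightarrow> 's \<Rightarrow> 't \<Rightarrow> 'o \<Rightarrow> 'a"
  where "counit_at H A B l X = (l \<star>\<^sub>m\<^bsub>M\<^esub> Ident M X) \<cdot>\<^bsub>M\<^esub> act_assoc_inv H (A \<boxtimes>\<^bsub>S\<^esub> B) X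
    \<cdot>\<^bsub>M\<^esub> (Ident S H \<star>\<^sub>m\<^bsub>M\<^esub> act_assoc_inv A B X)"

definition unit_at :: "'s \<Rightarrow> 's \<Rightarrow> 's \<Rightarrow> 't \<Rightarrow> 'o \<Rightarrow> 'a"
  where "unit_at H A B l X = act_assoc3 S M H A B X \<cdot>\<^bsub>M\<^esub> (l \<star>\<^sub>m\<^bsub>M\<^esub> Ident M X)"

section \<open>Typing and naturality of the prescribed values\<close>

lemma counit_at_arrow:
  assumes "H \<in> Ob S" "A \<in> Ob S" "B \<in> Ob S" "X \<in> Ob M" "in_hom S l (H \<boxtimes>\<^bsub>S\<^esub> (A \<boxtimes>\<^bsub>S\<^esub> B)) H"
  shows "in_hom M (counit_at H A B l X) (H \<star>\<^bsub>M\<^esub> A \<star>\<^bsub>M\<^esub> B \<star>\<^bsub>M\<^esub> X) (H \<star>\<^bsub>M\<^esub> X)"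
  using assms unfolding counit_at_def C.in_hom_iff S.B.in_hom_iff by (simp add: coherence_simps)

lemma unit_at_arrow:
  assumes "H \<in> Ob S" "A \<in> Ob S" "B \<in> Ob S" "X \<in> Ob M" "in_hom S l H (H \<boxtimes>\<^bsub>S\<^esub> (A \<boxtimes>\<^bsub>S\<^esub> B))"
  shows "in_hom M (unit_at H A B l X) (H \<star>\<^bsub>M\<^esub> X) (H \<star>\<^bsub>M\<^esub> A \<star>\<^bsub>M\<^esub> B \<star>\<^bsub>M\<^esub> X)"
  using assms unfolding unit_at_def act_assoc3_def C.in_hom_iff S.B.in_hom_iff
  by (simp add: coherence_simps)

text \<open>The two inverse associators in \<open>counit_at\<close> undo \<open>act_assoc3\<close>,
  so \<open>counit_at\<close> solves the counit equation of \<open>respected_in\<close>.\<close>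

lemma counit_at_act_assoc3:
  assumes "H \<in> Ob S" "A \<in> Ob S" "B \<in> Ob S" "X \<in> Ob M" "in_hom S l (H \<boxtimes>\<^bsub>S\<^esub> (A \<boxtimes>\<^bsub>S\<^esub> B)) H"
  shows "counit_at H A B l X \<cdot>\<^bsub>M\<^esub> act_assoc3 S M H A B X = l \<star>\<^sub>m\<^bsub>M\<^esub> Ident M X"
  using assms unfolding counit_at_def act_assoc3_def S.B.in_hom_iff
  by (simp add: coherence_simps)

text \<open>The arrow \<open>x\<close> slides past the inner inverse associator (fact
  \<open>1\<close>), then the outer one (fact \<open>2\<close>), and finally past \<open>l\<close>
  by interchange.\<close>

lemma counit_at_natural:
  assumes ob: "H \<in> Ob S" "A \<in> Ob S" "B \<in> Ob S"
    and l: "in_hom S l (H \<boxtimes>\<^bsub>S\<^esub> (A \<boxtimes>\<^bsub>S\<^esub> B)) H" and x: "in_hom M x X Y"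
  shows "counit_at H A B l Y \<cdot>\<^bsub>M\<^esub> (Ident S H \<star>\<^sub>m\<^bsub>M\<^esub> Ident S A \<star>\<^sub>m\<^bsub>M\<^esub> Ident S B \<star>\<^sub>m\<^bsub>M\<^esub> x)
    = (Ident S H \<star>\<^sub>m\<^bsub>M\<^esub> x) \<cdot>\<^bsub>M\<^esub> counit_at H A B l X"
proof -
  let ?P = "A \<boxtimes>\<^bsub>S\<^esub> B"
  have P: "?P \<in> Ob S" and XY: "X \<in> Ob M" "Y \<in> Ob M"
    using x ob by (simp_all add: in_hom_def S.to_closed)
  note t = ob P XY l[unfolded S.B.in_hom_iff] x[unfolded C.in_hom_iff]
  note id = S.B.Ident_arrow
  have 1: "act_assoc_inv A B Y \<cdot>\<^bsub>M\<^esub> (Ident S A \<star>\<^sub>m\<^bsub>M\<^esub> Ident S B \<star>\<^sub>m\<^bsub>M\<^esub> x)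
      = (Ident S ?P \<star>\<^sub>m\<^bsub>M\<^esub> x) \<cdot>\<^bsub>M\<^esub> act_assoc_inv A B X"
    using act_assoc_inv_natural[OF id[OF ob(2)] id[OF ob(3)] x] by (simp add: S.ta_Ident ob)
  have 2: "act_assoc_inv H ?P Y \<cdot>\<^bsub>M\<^esub> (Ident S H \<star>\<^sub>m\<^bsub>M\<^esub> Ident S ?P \<star>\<^sub>m\<^bsub>M\<^esub> x)
      = (Ident S (H \<boxtimes>\<^bsub>S\<^esub> ?P) \<star>\<^sub>m\<^bsub>M\<^esub> x) \<cdot>\<^bsub>M\<^esub> act_assoc_inv H ?P X"
    using act_assoc_inv_natural[OF id[OF ob(1)] id[OF P] x] by (simp add: S.ta_Ident ob P)
  have "counit_at H A B l Y \<cdot>\<^bsub>M\<^esub> (Ident S H \<star>\<^sub>m\<^bsub>M\<^esub> Ident S A \<star>\<^sub>m\<^bsub>M\<^esub> Ident S B \<star>\<^sub>m\<^bsub>M\<^esub> x)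
    = (l \<star>\<^sub>m\<^bsub>M\<^esub> Ident M Y) \<cdot>\<^bsub>M\<^esub> act_assoc_inv H ?P Y
        \<cdot>\<^bsub>M\<^esub> (Ident S H \<star>\<^sub>m\<^bsub>M\<^esub> (act_assoc_inv A B Y \<cdot>\<^bsub>M\<^esub> (Ident S A \<star>\<^sub>m\<^bsub>M\<^esub> Ident S B \<star>\<^sub>m\<^bsub>M\<^esub> x)))"
    unfolding counit_at_def by (simp add: coherence_simps t)
  also have "\<dots> = (l \<star>\<^sub>m\<^bsub>M\<^esub> Ident M Y)
      \<cdot>\<^bsub>M\<^esub> (act_assoc_inv H ?P Y \<cdot>\<^bsub>M\<^esub> (Ident S H \<star>\<^sub>m\<^bsub>M\<^esub> Ident S ?P \<star>\<^sub>m\<^bsub>M\<^esub> x))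
      \<cdot>\<^bsub>M\<^esub> (Ident S H \<star>\<^sub>m\<^bsub>M\<^esub> act_assoc_inv A B X)"
    unfolding 1 by (simp add: coherence_simps t)
  also have "\<dots> = (Ident S H \<star>\<^sub>m\<^bsub>M\<^esub> x) \<cdot>\<^bsub>M\<^esub> counit_at H A B l X"
    unfolding 2 counit_at_def by (simp add: coherence_simps t)
  finally show ?thesis .
qed

text \<open>The arrow \<open>x\<close> passes \<open>l\<close> by interchange, then the outer
  associator (fact \<open>2\<close>) and the inner one (fact \<open>1\<close>).\<close>

lemma unit_at_natural:
  assumes ob: "H \<in> Ob S" "A \<in> Ob S" "B \<in> Ob S"
    and l: "in_hom S l H (H \<boxtimes>\<^bsub>S\<^esub> (A \<boxtimes>\<^bsub>S\<^esub> B))" and x: "in_hom M x X Y"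
  shows "unit_at H A B l Y \<cdot>\<^bsub>M\<^esub> (Ident S H \<star>\<^sub>m\<^bsub>M\<^esub> x)
    = (Ident S H \<star>\<^sub>m\<^bsub>M\<^esub> Ident S A \<star>\<^sub>m\<^bsub>M\<^esub> Ident S B \<star>\<^sub>m\<^bsub>M\<^esub> x) \<cdot>\<^bsub>M\<^esub> unit_at H A B l X"
proof -
  let ?P = "A \<boxtimes>\<^bsub>S\<^esub> B"
  have P: "?P \<in> Ob S" and XY: "X \<in> Ob M" "Y \<in> Ob M"
    using x ob by (simp_all add: in_hom_def S.to_closed)
  note t = ob P XY l[unfolded S.B.in_hom_iff] x[unfolded C.in_hom_iff]
  note id = S.B.Ident_arrow
  have 1: "act_assoc M A B Y \<cdot>\<^bsub>M\<^esub> (Ident S ?P \<star>\<^sub>m\<^bsub>M\<^esub> x)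
      = (Ident S A \<star>\<^sub>m\<^bsub>M\<^esub> Ident S B \<star>\<^sub>m\<^bsub>M\<^esub> x) \<cdot>\<^bsub>M\<^esub> act_assoc M A B X"
    using act_assoc_natural_arrow[OF id[OF ob(2)] id[OF ob(3)] x] by (simp add: S.ta_Ident ob)
  have 2: "act_assoc M H ?P Y \<cdot>\<^bsub>M\<^esub> (Ident S (H \<boxtimes>\<^bsub>S\<^esub> ?P) \<star>\<^sub>m\<^bsub>M\<^esub> x)
      = (Ident S H \<star>\<^sub>m\<^bsub>M\<^esub> Ident S ?P \<star>\<^sub>m\<^bsub>M\<^esub> x) \<cdot>\<^bsub>M\<^esub> act_assoc M H ?P X"
    using act_assoc_natural_arrow[OF id[OF ob(1)] id[OF P] x] by (simp add: S.ta_Ident ob P)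
  have "unit_at H A B l Y \<cdot>\<^bsub>M\<^esub> (Ident S H \<star>\<^sub>m\<^bsub>M\<^esub> x)
    = (Ident S H \<star>\<^sub>m\<^bsub>M\<^esub> act_assoc M A B Y)
      \<cdot>\<^bsub>M\<^esub> (act_assoc M H ?P Y \<cdot>\<^bsub>M\<^esub> (Ident S (H \<boxtimes>\<^bsub>S\<^esub> ?P) \<star>\<^sub>m\<^bsub>M\<^esub> x)) \<cdot>\<^bsub>M\<^esub> (l \<star>\<^sub>m\<^bsub>M\<^esub> Ident M X)"
    unfolding unit_at_def act_assoc3_def by (simp add: coherence_simps t)
  also have "\<dots> = (Ident S H \<star>\<^sub>m\<^bsub>M\<^esub> (act_assoc M A B Y \<cdot>\<^bsub>M\<^esub> (Ident S ?P \<star>\<^sub>m\<^bsub>M\<^esub> x)))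
      \<cdot>\<^bsub>M\<^esub> act_assoc M H ?P X \<cdot>\<^bsub>M\<^esub> (l \<star>\<^sub>m\<^bsub>M\<^esub> Ident M X)"
    unfolding 2 by (simp add: coherence_simps t)
  also have "\<dots> = (Ident S H \<star>\<^sub>m\<^bsub>M\<^esub> Ident S A \<star>\<^sub>m\<^bsub>M\<^esub> Ident S B \<star>\<^sub>m\<^bsub>M\<^esub> x) \<cdot>\<^bsub>M\<^esub> unit_at H A B l X"
    unfolding 1 unit_at_def act_assoc3_def by (simp add: coherence_simps t)
  finally show ?thesis .
qed

text \<open>The conditions (IV) relating \<open>l\<close> and \<open>r\<close> say that \<open>l\<close> acts on \<open>D \<star> X\<close> as \<open>r\<close> does
  after applying \<open>H\<close>.\<close>

lemma counit_exchange_act: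
  assumes ob: "H \<in> Ob S" "P \<in> Ob S" "D \<in> Ob S" "X \<in> Ob M"
    and l: "in_hom S l (H \<boxtimes>\<^bsub>S\<^esub> P) H" and r: "in_hom S r (P \<boxtimes>\<^bsub>S\<^esub> D) D"
    and lr: "(Ident S H \<boxtimes>\<^sub>m\<^bsub>S\<^esub> r) \<cdot>\<^bsub>S\<^esub> assoc S H P D = l \<boxtimes>\<^sub>m\<^bsub>S\<^esub> Ident S D"
  shows "Ident S H \<star>\<^sub>m\<^bsub>M\<^esub> ((r \<star>\<^sub>m\<^bsub>M\<^esub> Ident M X) \<cdot>\<^bsub>M\<^esub> act_assoc_inv P D X)
    = (l \<star>\<^sub>m\<^bsub>M\<^esub> Ident M (D \<star>\<^bsub>M\<^esub> X)) \<cdot>\<^bsub>M\<^esub> act_assoc_inv H P (D \<star>\<^bsub>M\<^esub> X)"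
proof -
  note t = ob l[unfolded S.B.in_hom_iff] r[unfolded S.B.in_hom_iff]
  have nat_r: "act_assoc M H D X \<cdot>\<^bsub>M\<^esub> ((Ident S H \<boxtimes>\<^sub>m\<^bsub>S\<^esub> r) \<star>\<^sub>m\<^bsub>M\<^esub> Ident M X)
      = (Ident S H \<star>\<^sub>m\<^bsub>M\<^esub> r \<star>\<^sub>m\<^bsub>M\<^esub> Ident M X) \<cdot>\<^bsub>M\<^esub> act_assoc M H (P \<boxtimes>\<^bsub>S\<^esub> D) X"
    by (rule act_assoc_natural_arrow[OF S.B.Ident_arrow[OF ob(1)] r C.Ident_arrow[OF ob(4)]])
  have nat_l: "act_assoc M H D X \<cdot>\<^bsub>M\<^esub> ((l \<boxtimes>\<^sub>m\<^bsub>S\<^esub> Ident S D) \<star>\<^sub>m\<^bsub>M\<^esub> Ident M X)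
      = (l \<star>\<^sub>m\<^bsub>M\<^esub> Ident M (D \<star>\<^bsub>M\<^esub> X)) \<cdot>\<^bsub>M\<^esub> act_assoc M (H \<boxtimes>\<^bsub>S\<^esub> P) D X"
    using act_assoc_natural_arrow[OF l S.B.Ident_arrow[OF ob(3)] C.Ident_arrow[OF ob(4)]]
    by (simp add: ta_Ident ob)
  have coh: "act_assoc M H P (D \<star>\<^bsub>M\<^esub> X) \<cdot>\<^bsub>M\<^esub> act_assoc M (H \<boxtimes>\<^bsub>S\<^esub> P) D X
      = (Ident S H \<star>\<^sub>m\<^bsub>M\<^esub> act_assoc M P D X) \<cdot>\<^bsub>M\<^esub> act_assoc M H (P \<boxtimes>\<^bsub>S\<^esub> D) X
          \<cdot>\<^bsub>M\<^esub> (assoc S H P D \<star>\<^sub>m\<^bsub>M\<^esub> Ident M X)"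
    by (rule act_coherence[OF ob])
  let ?f = "Ident S H \<star>\<^sub>m\<^bsub>M\<^esub> ((r \<star>\<^sub>m\<^bsub>M\<^esub> Ident M X) \<cdot>\<^bsub>M\<^esub> act_assoc_inv P D X)"
  let ?a = "act_assoc M H P (D \<star>\<^bsub>M\<^esub> X)" and ?b = "act_assoc M (H \<boxtimes>\<^bsub>S\<^esub> P) D X"
  let ?a' = "act_assoc_inv H P (D \<star>\<^bsub>M\<^esub> X)" and ?b' = "act_assoc_inv (H \<boxtimes>\<^bsub>S\<^esub> P) D X"
  \<comment> \<open>Start from \<open>((H \<boxtimes> P) \<boxtimes> D) \<star> X\<close> by
    inserting the invertible composite of \<open>?b\<close> and \<open>?a\<close>; there
    \<open>coh\<close> rewrites it into a form involving \<open>assoc S H P D\<close>.\<close>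
  have "?f = ?f \<cdot>\<^bsub>M\<^esub> (?a \<cdot>\<^bsub>M\<^esub> ?b) \<cdot>\<^bsub>M\<^esub> ?b' \<cdot>\<^bsub>M\<^esub> ?a'"
    by (simp add: coherence_simps t)
  also have "\<dots> = ((Ident S H \<star>\<^sub>m\<^bsub>M\<^esub> r \<star>\<^sub>m\<^bsub>M\<^esub> Ident M X) \<cdot>\<^bsub>M\<^esub> act_assoc M H (P \<boxtimes>\<^bsub>S\<^esub> D) X)
      \<cdot>\<^bsub>M\<^esub> (assoc S H P D \<star>\<^sub>m\<^bsub>M\<^esub> Ident M X) \<cdot>\<^bsub>M\<^esub> ?b' \<cdot>\<^bsub>M\<^esub> ?a'"
    unfolding coh by (simp add: coherence_simps t)
  \<comment> \<open>Naturality brings \<open>r\<close> inside the product of \<open>S\<close>, next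
    to \<open>assoc S H P D\<close>, so that \<open>lr\<close> can trade it for
    \<open>l\<close>.\<close>
  also have "\<dots> = act_assoc M H D X
      \<cdot>\<^bsub>M\<^esub> (((Ident S H \<boxtimes>\<^sub>m\<^bsub>S\<^esub> r) \<cdot>\<^bsub>S\<^esub> assoc S H P D) \<star>\<^sub>m\<^bsub>M\<^esub> Ident M X) \<cdot>\<^bsub>M\<^esub> ?b' \<cdot>\<^bsub>M\<^esub> ?a'"
    unfolding nat_r[symmetric] by (simp add: coherence_simps t)
  also have "\<dots> = (act_assoc M H D X \<cdot>\<^bsub>M\<^esub> ((l \<boxtimes>\<^sub>m\<^bsub>S\<^esub> Ident S D) \<star>\<^sub>m\<^bsub>M\<^esub> Ident M X)) \<cdot>\<^bsub>M\<^esub> ?b' \<cdot>\<^bsub>M\<^esub> ?a'"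
    unfolding lr by (simp add: coherence_simps t)
  also have "\<dots> = (l \<star>\<^sub>m\<^bsub>M\<^esub> Ident M (D \<star>\<^bsub>M\<^esub> X)) \<cdot>\<^bsub>M\<^esub> ?a'"
    unfolding nat_l by (simp add: coherence_simps t)
  finally show ?thesis .
qed

lemma unit_exchange_act:
  assumes ob: "H \<in> Ob S" "P \<in> Ob S" "D \<in> Ob S" "X \<in> Ob M"
    and l: "in_hom S l H (H \<boxtimes>\<^bsub>S\<^esub> P)" and r: "in_hom S r D (P \<boxtimes>\<^bsub>S\<^esub> D)"
    and lr: "Ident S H \<boxtimes>\<^sub>m\<^bsub>S\<^esub> r = assoc S H P D \<cdot>\<^bsub>S\<^esub> (l \<boxtimes>\<^sub>m\<^bsub>S\<^esub> Ident S D)"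
  shows "Ident S H \<star>\<^sub>m\<^bsub>M\<^esub> (act_assoc M P D X \<cdot>\<^bsub>M\<^esub> (r \<star>\<^sub>m\<^bsub>M\<^esub> Ident M X))
    = act_assoc M H P (D \<star>\<^bsub>M\<^esub> X) \<cdot>\<^bsub>M\<^esub> (l \<star>\<^sub>m\<^bsub>M\<^esub> Ident M (D \<star>\<^bsub>M\<^esub> X))"
proof -
  note t = ob l[unfolded S.B.in_hom_iff] r[unfolded S.B.in_hom_iff]
  have nat_r: "act_assoc M H (P \<boxtimes>\<^bsub>S\<^esub> D) X \<cdot>\<^bsub>M\<^esub> ((Ident S H \<boxtimes>\<^sub>m\<^bsub>S\<^esub> r) \<star>\<^sub>m\<^bsub>M\<^esub> Ident M X)
      = (Ident S H \<star>\<^sub>m\<^bsub>M\<^esub> r \<star>\<^sub>m\<^bsub>M\<^esub> Ident M X) \<cdot>\<^bsub>M\<^esub> act_assoc M H D X"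
    by (rule act_assoc_natural_arrow[OF S.B.Ident_arrow[OF ob(1)] r C.Ident_arrow[OF ob(4)]])
  have nat_l: "act_assoc M (H \<boxtimes>\<^bsub>S\<^esub> P) D X \<cdot>\<^bsub>M\<^esub> ((l \<boxtimes>\<^sub>m\<^bsub>S\<^esub> Ident S D) \<star>\<^sub>m\<^bsub>M\<^esub> Ident M X)
      = (l \<star>\<^sub>m\<^bsub>M\<^esub> Ident M (D \<star>\<^bsub>M\<^esub> X)) \<cdot>\<^bsub>M\<^esub> act_assoc M H D X"
    using act_assoc_natural_arrow[OF l S.B.Ident_arrow[OF ob(3)] C.Ident_arrow[OF ob(4)]]
    by (simp add: ta_Ident ob)
  have coh: "act_assoc M H P (D \<star>\<^bsub>M\<^esub> X) \<cdot>\<^bsub>M\<^esub> act_assoc M (H \<boxtimes>\<^bsub>S\<^esub> P) D X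
      = (Ident S H \<star>\<^sub>m\<^bsub>M\<^esub> act_assoc M P D X) \<cdot>\<^bsub>M\<^esub> act_assoc M H (P \<boxtimes>\<^bsub>S\<^esub> D) X
          \<cdot>\<^bsub>M\<^esub> (assoc S H P D \<star>\<^sub>m\<^bsub>M\<^esub> Ident M X)"
    by (rule act_coherence[OF ob])
  let ?a = "act_assoc M H D X" and ?a' = "act_assoc_inv H D X"
  \<comment> \<open>An inserted associator at the source lets \<open>r\<close> move inside the
    product of \<open>S\<close>, where \<open>lr\<close> applies.\<close>
  have "Ident S H \<star>\<^sub>m\<^bsub>M\<^esub> (act_assoc M P D X \<cdot>\<^bsub>M\<^esub> (r \<star>\<^sub>m\<^bsub>M\<^esub> Ident M X))
    = (Ident S H \<star>\<^sub>m\<^bsub>M\<^esub> act_assoc M P D X)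
      \<cdot>\<^bsub>M\<^esub> ((Ident S H \<star>\<^sub>m\<^bsub>M\<^esub> r \<star>\<^sub>m\<^bsub>M\<^esub> Ident M X) \<cdot>\<^bsub>M\<^esub> ?a) \<cdot>\<^bsub>M\<^esub> ?a'"
    by (simp add: coherence_simps t)
  also have "\<dots> = ((Ident S H \<star>\<^sub>m\<^bsub>M\<^esub> act_assoc M P D X) \<cdot>\<^bsub>M\<^esub> act_assoc M H (P \<boxtimes>\<^bsub>S\<^esub> D) X
          \<cdot>\<^bsub>M\<^esub> (assoc S H P D \<star>\<^sub>m\<^bsub>M\<^esub> Ident M X))
      \<cdot>\<^bsub>M\<^esub> ((l \<boxtimes>\<^sub>m\<^bsub>S\<^esub> Ident S D) \<star>\<^sub>m\<^bsub>M\<^esub> Ident M X) \<cdot>\<^bsub>M\<^esub> ?a'"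
    unfolding nat_r[symmetric] lr by (simp add: coherence_simps t)
  also have "\<dots> = act_assoc M H P (D \<star>\<^bsub>M\<^esub> X)
      \<cdot>\<^bsub>M\<^esub> (act_assoc M (H \<boxtimes>\<^bsub>S\<^esub> P) D X \<cdot>\<^bsub>M\<^esub> ((l \<boxtimes>\<^sub>m\<^bsub>S\<^esub> Ident S D) \<star>\<^sub>m\<^bsub>M\<^esub> Ident M X)) \<cdot>\<^bsub>M\<^esub> ?a'"
    unfolding coh[symmetric] by (simp add: coherence_simps t)
  also have "\<dots> = act_assoc M H P (D \<star>\<^bsub>M\<^esub> X) \<cdot>\<^bsub>M\<^esub> (l \<star>\<^sub>m\<^bsub>M\<^esub> Ident M (D \<star>\<^bsub>M\<^esub> X))"
    unfolding nat_l by (simp add: coherence_simps t)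
  finally show ?thesis .
qed

lemma assoc_cancel:
  assumes "A \<in> Ob S" "B \<in> Ob S" "D \<in> Ob S" "is_arrow S z"
    and "target S z = A \<boxtimes>\<^bsub>S\<^esub> (B \<boxtimes>\<^bsub>S\<^esub> D)"
  shows "assoc S A B D \<cdot>\<^bsub>S\<^esub> inv_assoc S A B D \<cdot>\<^bsub>S\<^esub> z = z"
  using assms by (simp add: S.B.Comp_assoc_source_target[symmetric] assoc_simps
      S.B.Ident_target_Comp)

text \<open>The first equation of (III), acted on \<open>X\<close>: all action associators cancel by
  coherence, leaving the zigzag in \<open>S\<close> acting on \<open>X\<close>.\<close>

lemma zigzag_counit_act:
  assumes ob: "A \<in> Ob S" "B \<in> Ob S" "X \<in> Ob M"
    and l: "in_hom S l A (A \<boxtimes>\<^bsub>S\<^esub> (B \<boxtimes>\<^bsub>S\<^esub> A))" and r: "in_hom S r (A \<boxtimes>\<^bsub>S\<^esub> B \<boxtimes>\<^bsub>S\<^esub> A) A"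
    and zz: "r \<cdot>\<^bsub>S\<^esub> inv_assoc S A B A \<cdot>\<^bsub>S\<^esub> l = Ident S A"
  shows "(((r \<star>\<^sub>m\<^bsub>M\<^esub> Ident M X) \<cdot>\<^bsub>M\<^esub> act_assoc_inv (A \<boxtimes>\<^bsub>S\<^esub> B) A X)
      \<cdot>\<^bsub>M\<^esub> act_assoc_inv A B (A \<star>\<^bsub>M\<^esub> X)) \<cdot>\<^bsub>M\<^esub> unit_at A B A l X = Ident M (A \<star>\<^bsub>M\<^esub> X)"
proof -
  note t = ob l[unfolded S.B.in_hom_iff] r[unfolded S.B.in_hom_iff]
  have coh: "act_assoc M A B (A \<star>\<^bsub>M\<^esub> X) \<cdot>\<^bsub>M\<^esub> act_assoc M (A \<boxtimes>\<^bsub>S\<^esub> B) A X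
      = (Ident S A \<star>\<^sub>m\<^bsub>M\<^esub> act_assoc M B A X) \<cdot>\<^bsub>M\<^esub> act_assoc M A (B \<boxtimes>\<^bsub>S\<^esub> A) X
          \<cdot>\<^bsub>M\<^esub> (assoc S A B A \<star>\<^sub>m\<^bsub>M\<^esub> Ident M X)"
    by (rule act_coherence[OF ob(1,2,1,3)])
  let ?p = "((r \<star>\<^sub>m\<^bsub>M\<^esub> Ident M X) \<cdot>\<^bsub>M\<^esub> act_assoc_inv (A \<boxtimes>\<^bsub>S\<^esub> B) A X)
      \<cdot>\<^bsub>M\<^esub> act_assoc_inv A B (A \<star>\<^bsub>M\<^esub> X)"
  \<comment> \<open>Write \<open>l\<close> as \<open>assoc S A B A\<close> after its inverse after
    \<open>l\<close>; this completes the right-hand side of \<open>coh\<close>.\<close>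
  have "?p \<cdot>\<^bsub>M\<^esub> unit_at A B A l X
    = ?p \<cdot>\<^bsub>M\<^esub> ((Ident S A \<star>\<^sub>m\<^bsub>M\<^esub> act_assoc M B A X) \<cdot>\<^bsub>M\<^esub> act_assoc M A (B \<boxtimes>\<^bsub>S\<^esub> A) X
        \<cdot>\<^bsub>M\<^esub> (assoc S A B A \<star>\<^sub>m\<^bsub>M\<^esub> Ident M X)) \<cdot>\<^bsub>M\<^esub> ((inv_assoc S A B A \<cdot>\<^bsub>S\<^esub> l) \<star>\<^sub>m\<^bsub>M\<^esub> Ident M X)"
    unfolding unit_at_def act_assoc3_def by (simp add: coherence_simps assoc_cancel t)
  also have "\<dots> = (r \<cdot>\<^bsub>S\<^esub> inv_assoc S A B A \<cdot>\<^bsub>S\<^esub> l) \<star>\<^sub>m\<^bsub>M\<^esub> Ident M X"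
    unfolding coh[symmetric] by (simp add: coherence_simps t)
  finally show ?thesis
    by (simp add: zz ta_Ident ob)
qed

text \<open>The second equation of (III), acted on \<open>X\<close>: coherence turns the two
  associators into \<open>act_assoc3\<close> after the action of \<open>assoc S B A B\<close>, and
  \<open>counit_at\<close> absorbs the former.\<close>

lemma zigzag_unit_act:
  assumes ob: "A \<in> Ob S" "B \<in> Ob S" "X \<in> Ob M"
    and l: "in_hom S l (B \<boxtimes>\<^bsub>S\<^esub> (A \<boxtimes>\<^bsub>S\<^esub> B)) B" and r: "in_hom S r B (B \<boxtimes>\<^bsub>S\<^esub> A \<boxtimes>\<^bsub>S\<^esub> B)"
    and zz: "l \<cdot>\<^bsub>S\<^esub> assoc S B A B \<cdot>\<^bsub>S\<^esub> r = Ident S B"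
  shows "counit_at B A B l X \<cdot>\<^bsub>M\<^esub> act_assoc M B A (B \<star>\<^bsub>M\<^esub> X)
      \<cdot>\<^bsub>M\<^esub> act_assoc M (B \<boxtimes>\<^bsub>S\<^esub> A) B X \<cdot>\<^bsub>M\<^esub> (r \<star>\<^sub>m\<^bsub>M\<^esub> Ident M X) = Ident M (B \<star>\<^bsub>M\<^esub> X)"
proof -
  note t = ob l[unfolded S.B.in_hom_iff] r[unfolded S.B.in_hom_iff]
  have coh: "act_assoc M B A (B \<star>\<^bsub>M\<^esub> X) \<cdot>\<^bsub>M\<^esub> act_assoc M (B \<boxtimes>\<^bsub>S\<^esub> A) B X
      = (Ident S B \<star>\<^sub>m\<^bsub>M\<^esub> act_assoc M A B X) \<cdot>\<^bsub>M\<^esub> act_assoc M B (A \<boxtimes>\<^bsub>S\<^esub> B) X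
          \<cdot>\<^bsub>M\<^esub> (assoc S B A B \<star>\<^sub>m\<^bsub>M\<^esub> Ident M X)"
    by (rule act_coherence[OF ob(2,1,2,3)])
  have "counit_at B A B l X \<cdot>\<^bsub>M\<^esub> act_assoc M B A (B \<star>\<^bsub>M\<^esub> X)
      \<cdot>\<^bsub>M\<^esub> act_assoc M (B \<boxtimes>\<^bsub>S\<^esub> A) B X \<cdot>\<^bsub>M\<^esub> (r \<star>\<^sub>m\<^bsub>M\<^esub> Ident M X)
    = counit_at B A B l X \<cdot>\<^bsub>M\<^esub> (act_assoc M B A (B \<star>\<^bsub>M\<^esub> X)
      \<cdot>\<^bsub>M\<^esub> act_assoc M (B \<boxtimes>\<^bsub>S\<^esub> A) B X) \<cdot>\<^bsub>M\<^esub> (r \<star>\<^sub>m\<^bsub>M\<^esub> Ident M X)"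
    unfolding counit_at_def by (simp add: coherence_simps t)
  also have "\<dots> = (l \<cdot>\<^bsub>S\<^esub> assoc S B A B \<cdot>\<^bsub>S\<^esub> r) \<star>\<^sub>m\<^bsub>M\<^esub> Ident M X"
    unfolding coh counit_at_def by (simp add: coherence_simps t)
  finally show ?thesis
    by (simp add: zz ta_Ident ob)
qed

lemma act_fctr_linear:
  assumes H: "H \<in> Ob S"
  shows "linear_functor K M M (act_fctr S M H)"
proof
  fix X assume X: "X \<in> Ob M"
  then show "fobj (act_fctr S M H) X \<in> Ob M"
    by (simp add: act_fctr_def to_closed H)
  show "farr (act_fctr S M H) (Ident M X) = Ident M (fobj (act_fctr S M H) X)"
    by (simp add: act_fctr_def ta_Ident H X)
next
  fix X Y assume "X \<in> Ob M" "Y \<in> Ob M"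
  then show "linear_map K (Hom M X Y) (Hom M (fobj (act_fctr S M H) X) (fobj (act_fctr S M H) Y))
      (farr (act_fctr S M H))"
    using ta_bilinear[OF H H, of X Y] S.B.Ident_in_hom[OF H]
    by (simp add: act_fctr_def bilinear_map_def)
next
  fix X Y Z f g
  assume "X \<in> Ob M" "Y \<in> Ob M" "Z \<in> Ob M" "f \<in> hom_set M X Y" "g \<in> hom_set M Y Z"
  then have "in_hom M f X Y" "in_hom M g Y Z"
    by (simp_all add: in_hom_def)
  then show "farr (act_fctr S M H) (g \<cdot>\<^bsub>M\<^esub> f)
      = farr (act_fctr S M H) g \<cdot>\<^bsub>M\<^esub> farr (act_fctr S M H) f"
    unfolding C.in_hom_iff by (simp add: act_fctr_def coherence_simps H)
qed

end

section \<open>Respected adjunctions\<close>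

context semigroup_adjunction
begin

text \<open>The typings are part of naturality of the four module transformations. Over
  \<open>rev_cat S\<close> the product is reversed, which puts \<open>H\<close> on the
  right.\<close>

lemma counit_left_arrow: "H \<in> Ob S \<Longrightarrow> in_hom S (\<epsilon>l H) (H \<boxtimes>\<^bsub>S\<^esub> (F \<boxtimes>\<^bsub>S\<^esub> F')) H"
  and unit_left_arrow: "H \<in> Ob S \<Longrightarrow> in_hom S (\<eta>l H) H (H \<boxtimes>\<^bsub>S\<^esub> (F' \<boxtimes>\<^bsub>S\<^esub> F))"
  and counit_right_arrow: "H \<in> Ob S \<Longrightarrow> in_hom S (\<epsilon>r H) (F \<boxtimes>\<^bsub>S\<^esub> F' \<boxtimes>\<^bsub>S\<^esub> H) H"
  and unit_right_arrow: "H \<in> Ob S \<Longrightarrow> in_hom S (\<eta>r H) H (F' \<boxtimes>\<^bsub>S\<^esub> F \<boxtimes>\<^bsub>S\<^esub> H)"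
  using module_transf.natural[OF \<epsilon>l_transf] module_transf.natural[OF \<eta>l_transf]
    module_transf.natural[OF \<epsilon>r_transf] module_transf.natural[OF \<eta>r_transf] F_Ob F'_Ob
  by (simp_all add: nat_transf_def in_hom_def regular_def rev_cat_def mul_fctr_def id_fctr_def
      to_closed)

end

locale semigroup_adjunction_on_module =
  semigroup_module_category K S M + A: semigroup_adjunction K S F F' \<eta>l \<eta>r \<epsilon>l \<epsilon>r
  for K (structure)
    and S :: "('s, 't, 'k, 'y) semigroup_cat_scheme"
    and M :: "('s, 't, 'o, 'a, 'k, 'z) module_cat_scheme"
    and F F' :: 's
    and \<eta>l \<eta>r \<epsilon>l \<epsilon>r :: "'s \<Rightarrow> 't"
begin

text \<open>The arrow \<open>\<epsilon>r F \<star> X\<close> with its source fully rebracketed to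
  the right; this is \<open>p\<close> in \<open>adjunction_correction\<close>.\<close>

definition counit_F :: "'o \<Rightarrow> 'a"
  where "counit_F X = ((\<epsilon>r F \<star>\<^sub>m\<^bsub>M\<^esub> Ident M X) \<cdot>\<^bsub>M\<^esub> act_assoc_inv (F \<boxtimes>\<^bsub>S\<^esub> F') F X)
    \<cdot>\<^bsub>M\<^esub> act_assoc_inv F F' (F \<star>\<^bsub>M\<^esub> X)"

text \<open>Likewise \<open>\<eta>r F' \<star> X\<close> with its target rebracketed; this is
  \<open>q\<close>.\<close>

definition unit_F' :: "'o \<Rightarrow> 'a"
  where "unit_F' X = act_assoc M F' F (F' \<star>\<^bsub>M\<^esub> X) \<cdot>\<^bsub>M\<^esub> act_assoc M (F' \<boxtimes>\<^bsub>S\<^esub> F) F' X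
    \<cdot>\<^bsub>M\<^esub> (\<eta>r F' \<star>\<^sub>m\<^bsub>M\<^esub> Ident M X)"

lemma counit_F_arrow:
  "X \<in> Ob M \<Longrightarrow> in_hom M (counit_F X) (F \<star>\<^bsub>M\<^esub> F' \<star>\<^bsub>M\<^esub> F \<star>\<^bsub>M\<^esub> X) (F \<star>\<^bsub>M\<^esub> X)"
  using A.counit_right_arrow[OF A.F_Ob] A.F_Ob A.F'_Ob
  unfolding counit_F_def C.in_hom_iff S.B.in_hom_iff by (simp add: coherence_simps)

lemma unit_F'_arrow:
  "X \<in> Ob M \<Longrightarrow> in_hom M (unit_F' X) (F' \<star>\<^bsub>M\<^esub> X) (F' \<star>\<^bsub>M\<^esub> F \<star>\<^bsub>M\<^esub> F' \<star>\<^bsub>M\<^esub> X)"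
  using A.unit_right_arrow[OF A.F'_Ob] A.F_Ob A.F'_Ob
  unfolding unit_F'_def C.in_hom_iff S.B.in_hom_iff by (simp add: coherence_simps)

text \<open>The counit half of (IV) at \<open>F\<close>, acted on \<open>X\<close>. It is used at
  \<open>H = F'\<close> for \<open>R_p\<close>, and at every \<open>H\<close> to compare with the
  prescribed counit on the image of \<open>F \<star> -\<close>.\<close>

lemma act_counit_F:
  assumes H: "H \<in> Ob S" and X: "X \<in> Ob M"
  shows "Ident S H \<star>\<^sub>m\<^bsub>M\<^esub> counit_F X = counit_at H F F' (\<epsilon>l H) (F \<star>\<^bsub>M\<^esub> X)"
proof -
  note ob = A.F_Ob A.F'_Ob
  note l = A.counit_left_arrow[OF H] and r = A.counit_right_arrow[OF ob(1)]
  note t = H X ob l[unfolded S.B.in_hom_iff] r[unfolded S.B.in_hom_iff]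
  have "Ident S H \<star>\<^sub>m\<^bsub>M\<^esub> counit_F X
    = (Ident S H \<star>\<^sub>m\<^bsub>M\<^esub> ((\<epsilon>r F \<star>\<^sub>m\<^bsub>M\<^esub> Ident M X) \<cdot>\<^bsub>M\<^esub> act_assoc_inv (F \<boxtimes>\<^bsub>S\<^esub> F') F X))
      \<cdot>\<^bsub>M\<^esub> (Ident S H \<star>\<^sub>m\<^bsub>M\<^esub> act_assoc_inv F F' (F \<star>\<^bsub>M\<^esub> X))"
    unfolding counit_F_def by (simp add: coherence_simps t)
  also have "\<dots> = counit_at H F F' (\<epsilon>l H) (F \<star>\<^bsub>M\<^esub> X)"
    unfolding counit_exchange_act[OF H S.to_closed[OF ob] ob(1) X l r A.counit_exchange[OF H ob(1)]]
      counit_at_def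
    by (simp add: coherence_simps t)
  finally show ?thesis .
qed

text \<open>The unit half of (IV) at \<open>F'\<close>, acted on \<open>X\<close>; the case
  \<open>H = F\<close> gives \<open>L_q\<close>.\<close>

lemma act_unit_F':
  assumes H: "H \<in> Ob S" and X: "X \<in> Ob M"
  shows "Ident S H \<star>\<^sub>m\<^bsub>M\<^esub> unit_F' X = unit_at H F' F (\<eta>l H) (F' \<star>\<^bsub>M\<^esub> X)"
proof -
  note ob = A.F'_Ob A.F_Ob
  note l = A.unit_left_arrow[OF H] and r = A.unit_right_arrow[OF ob(1)]
  note t = H X ob l[unfolded S.B.in_hom_iff] r[unfolded S.B.in_hom_iff]
  have "Ident S H \<star>\<^sub>m\<^bsub>M\<^esub> unit_F' X
    = (Ident S H \<star>\<^sub>m\<^bsub>M\<^esub> act_assoc M F' F (F' \<star>\<^bsub>M\<^esub> X))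
      \<cdot>\<^bsub>M\<^esub> (Ident S H \<star>\<^sub>m\<^bsub>M\<^esub> (act_assoc M (F' \<boxtimes>\<^bsub>S\<^esub> F) F' X \<cdot>\<^bsub>M\<^esub> (\<eta>r F' \<star>\<^sub>m\<^bsub>M\<^esub> Ident M X)))"
    unfolding unit_F'_def by (simp add: coherence_simps t)
  also have "\<dots> = unit_at H F' F (\<eta>l H) (F' \<star>\<^bsub>M\<^esub> X)"
    unfolding unit_exchange_act[OF H S.to_closed[OF ob] ob(1) X l r A.unit_exchange[OF H ob(1)]]
      unit_at_def act_assoc3_def
    by (simp add: coherence_simps t)
  finally show ?thesis .
qed

lemma counit_at_nat_transf:
  assumes H: "H \<in> Ob S"
  shows "nat_transf M M
    (comp_fctr (act_fctr S M H) (comp_fctr (act_fctr S M F) (act_fctr S M F')))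
    (act_fctr S M H) (counit_at H F F' (\<epsilon>l H))"
  using counit_at_arrow[OF H A.F_Ob A.F'_Ob _ A.counit_left_arrow[OF H]]
    counit_at_natural[OF H A.F_Ob A.F'_Ob A.counit_left_arrow[OF H]]
  by (auto simp: nat_transf_def comp_fctr_def act_fctr_def in_hom_def)

lemma unit_at_nat_transf:
  assumes H: "H \<in> Ob S"
  shows "nat_transf M M (act_fctr S M H)
    (comp_fctr (act_fctr S M H) (comp_fctr (act_fctr S M F') (act_fctr S M F)))
    (unit_at H F' F (\<eta>l H))"
  using unit_at_arrow[OF H A.F'_Ob A.F_Ob _ A.unit_left_arrow[OF H]]
    unit_at_natural[OF H A.F'_Ob A.F_Ob A.unit_left_arrow[OF H]]
  by (auto simp: nat_transf_def comp_fctr_def act_fctr_def in_hom_def)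

text \<open>Here \<open>e\<close> and \<open>n\<close> are the prescribed values at
  \<open>H = F'\<close> and \<open>H = F\<close>. Condition (IV) relates them to
  \<open>counit_F\<close> and \<open>unit_F'\<close>, and the two equations of (III) give
  \<open>p_n\<close> and \<open>e_q\<close>.\<close>

lemma adjunction_correction_act:
  assumes "adjunction K M M (act_fctr S M F) (act_fctr S M F') \<eta> \<epsilon>"
  shows "adjunction_correction K M M (act_fctr S M F) (act_fctr S M F') \<eta> \<epsilon>
    (counit_at F' F F' (\<epsilon>l F')) (unit_at F F' F (\<eta>l F)) counit_F unit_F'"
proof (intro adjunction_correction.intro adjunction_correction_axioms.intro assms)
  note ob = A.F_Ob A.F'_Ob
  show "nat_transf M M
      (comp_fctr (act_fctr S M F') (comp_fctr (act_fctr S M F) (act_fctr S M F')))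
      (act_fctr S M F') (counit_at F' F F' (\<epsilon>l F'))"
    by (rule counit_at_nat_transf[OF ob(2)])
  show "nat_transf M M (act_fctr S M F)
      (comp_fctr (act_fctr S M F) (comp_fctr (act_fctr S M F') (act_fctr S M F)))
      (unit_at F F' F (\<eta>l F))"
    by (rule unit_at_nat_transf[OF ob(1)])
  fix X assume X: "X \<in> Ob M"
  show "in_hom M (counit_F X)
      (fobj (act_fctr S M F) (fobj (act_fctr S M F') (fobj (act_fctr S M F) X)))
      (fobj (act_fctr S M F) X)"
    using counit_F_arrow[OF X] by (simp add: act_fctr_def)
  show "in_hom M (unit_F' X) (fobj (act_fctr S M F') X)
      (fobj (act_fctr S M F') (fobj (act_fctr S M F) (fobj (act_fctr S M F') X)))"
    using unit_F'_arrow[OF X] by (simp add: act_fctr_def)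
  show "farr (act_fctr S M F') (counit_F X) = counit_at F' F F' (\<epsilon>l F') (fobj (act_fctr S M F) X)"
    using act_counit_F[OF ob(2) X] by (simp add: act_fctr_def)
  show "farr (act_fctr S M F) (unit_F' X) = unit_at F F' F (\<eta>l F) (fobj (act_fctr S M F') X)"
    using act_unit_F'[OF ob(1) X] by (simp add: act_fctr_def)
  show "counit_F X \<cdot>\<^bsub>M\<^esub> unit_at F F' F (\<eta>l F) X = Ident M (fobj (act_fctr S M F) X)"
    using zigzag_counit_act[OF ob X A.unit_left_arrow[OF ob(1)] A.counit_right_arrow[OF ob(1)]
        A.zigzag_F]
    by (simp add: counit_F_def act_fctr_def)
  show "counit_at F' F F' (\<epsilon>l F') X \<cdot>\<^bsub>M\<^esub> unit_F' X = Ident M (fobj (act_fctr S M F') X)"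
    using zigzag_unit_act[OF ob X A.counit_left_arrow[OF ob(2)] A.unit_right_arrow[OF ob(2)]
        A.zigzag_F']
    by (simp add: unit_F'_def act_fctr_def)
qed

lemma preserved_imp_respected:
  assumes "preserved_in K S M F F'"
  shows "respected_in K S M F F' \<eta>l \<eta>r \<epsilon>l \<epsilon>r"
proof -
  obtain \<eta> \<epsilon> where "adjunction K M M (act_fctr S M F) (act_fctr S M F') \<eta> \<epsilon>"
    using assms unfolding preserved_in_def adjoint_pair_def by blast
  then interpret N: adjunction_correction K M M "act_fctr S M F" "act_fctr S M F'" \<eta> \<epsilon>
      "counit_at F' F F' (\<epsilon>l F')" "unit_at F F' F (\<eta>l F)" counit_F unit_F'
    by (rule adjunction_correction_act)
  have "(Ident S H \<star>\<^sub>m\<^bsub>M\<^esub> N.new_counit X) \<cdot>\<^bsub>M\<^esub> act_assoc3 S M H F F' X = \<epsilon>l H \<star>\<^sub>m\<^bsub>M\<^esub> Ident M X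
      \<and> Ident S H \<star>\<^sub>m\<^bsub>M\<^esub> N.new_unit X = act_assoc3 S M H F' F X \<cdot>\<^bsub>M\<^esub> (\<eta>l H \<star>\<^sub>m\<^bsub>M\<^esub> Ident M X)"
    if H: "H \<in> Ob S" and X: "X \<in> Ob M" for H X
  proof
    \<comment> \<open>The comparison lemma is applied to the functor \<open>H \<star> -\<close>;
      agreement on the image of \<open>F \<star> -\<close> is \<open>act_counit_F\<close>.\<close>
    have "farr (act_fctr S M H) (N.new_counit X) = counit_at H F F' (\<epsilon>l H) X"
      by (rule N.farr_new_counit[OF act_fctr_linear[OF H] counit_at_nat_transf[OF H] _ X])
        (simp add: act_fctr_def act_counit_F[OF H])
    then show "(Ident S H \<star>\<^sub>m\<^bsub>M\<^esub> N.new_counit X) \<cdot>\<^bsub>M\<^esub> act_assoc3 S M H F F' X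
        = \<epsilon>l H \<star>\<^sub>m\<^bsub>M\<^esub> Ident M X"
      using counit_at_act_assoc3[OF H A.F_Ob A.F'_Ob X A.counit_left_arrow[OF H]]
      by (simp add: act_fctr_def)
    have "farr (act_fctr S M H) (N.new_unit X) = unit_at H F' F (\<eta>l H) X"
      by (rule N.farr_new_unit[OF act_fctr_linear[OF H] unit_at_nat_transf[OF H] _ X])
        (simp add: act_fctr_def act_unit_F'[OF H])
    then show "Ident S H \<star>\<^sub>m\<^bsub>M\<^esub> N.new_unit X
        = act_assoc3 S M H F' F X \<cdot>\<^bsub>M\<^esub> (\<eta>l H \<star>\<^sub>m\<^bsub>M\<^esub> Ident M X)"
      by (simp add: act_fctr_def unit_at_def)
  qed
  then show ?thesis
    using N.new_adjunction unfolding respected_in_def by blast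
qed

end

theorem proposition3p17:
  fixes K :: "('k, 'r) ring_scheme"
    and S :: "('s, 't, 'k, 'y) semigroup_cat_scheme"
    and M :: "('s, 't, 'o, 'a, 'k, 'z) module_cat_scheme"
    and F F' :: 's
    and \<eta>l \<eta>r \<epsilon>l \<epsilon>r :: "'s \<Rightarrow> 't"
  assumes "field K"
    and "semigroup_category K S"
    and "semigroup_adjunction K S F F' \<eta>l \<eta>r \<epsilon>l \<epsilon>r"
    and "semigroup_module_category K S M"
  shows "respected_in K S M F F' \<eta>l \<eta>r \<epsilon>l \<epsilon>r \<longleftrightarrow> preserved_in K S M F F'"
proof -
  interpret M: semigroup_module_category K S M
    by (rule assms(4))
  interpret A: semigroup_adjunction K S F F' \<eta>l \<eta>r \<epsilon>l \<epsilon>r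
    by (rule assms(3))
  interpret semigroup_adjunction_on_module K S M F F' \<eta>l \<eta>r \<epsilon>l \<epsilon>r ..
  \<comment> \<open>The forward direction keeps the adjunction and forgets the compatibility
    equations.\<close>
  show ?thesis
    using preserved_imp_respected
    unfolding preserved_in_def respected_in_def adjoint_pair_def by blast
qed

end
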